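(* Let $n\ge1$ and $y_1,\dots,y_n$ be fixed. Assume: (X1) the artificial data-points $(X_j)_{j\ge1}$ are realisations of a $\mathbb{P}_\psi$-ergodic process; (H2) the maps $\theta\mapsto h_\theta(x)$ are twice continuously differentiable in a neighbourhood of $\hat\theta_n$ for $\mathbb{P}_\psi$-almost every $x$, and for $x=y_i$, $i=1,\dots,n$; the Hessian matrix $\mathbf{H}=\nabla^2_\theta\ell_n(\hat\theta_n)$ of the log-likelihood $\ell_n(\theta)$ is invertible; and for some $\varepsilon>0$, $\int_{\mathcal{X}}a_\varepsilon(x)\sup_{\theta\in B(\hat\theta_n,\varepsilon)}h_\theta(x)\,\mu(\mathrm{d}x)<+\infty$, where $a_\varepsilon(x)=1+\sup_{\theta\in B(\hat\theta_n,\varepsilon)}\|\nabla_\theta\log h_\theta(x)\|^2+\sup_{\theta\in B(\hat\theta_n,\varepsilon)}\|\nabla^2_\theta\log h_\theta(x)\|$; (G1) the estimators $\hat\xi^{\mathrm{IS}}_{n,m}$ and $\hat\xi^{\mathrm{NCE}}_{n,m}$ converge to $\hat\xi_n$ almost surely as $m\to\infty$, and are such that $\nabla_\xi\ell^{\mathrm{IS}}_{n,m}(\hat\xi^{\mathrm{IS}}_{n,m})=o(m^{-1})$ and $\nabla_\xi\ell^{\mathrm{NCE}}_{n,m}(\hat\xi^{\mathrm{NCE}}_{n,m})=o(m^{-1})$ almost surely; (I1) for some $\varepsilon>0$, $\mathbb{E}_\psi\Big[b_\varepsilon(X)\sup_{\theta\in B(\hat\theta_n,\varepsilon)}\Big(\frac{h_\theta(X)}{h_\psi(X)}\Big)^2\Big]<+\infty$,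 where $b_\varepsilon(x)=1+\sup_{\theta\in B(\hat\theta_n,\varepsilon)}\|\nabla_\theta\log h_\theta(x)\|$. Then $$m\left(\hat\xi^{\mathrm{IS}}_{n,m}-\hat\xi^{\mathrm{NCE}}_{n,m}\right)\underset{m\to\infty}{\longrightarrow} n\left(-\mathcal{H}(\hat\xi_n)\right)^{-1}v(\hat\xi_n)\quad\text{almost surely},$$ where $\mathcal{H}(\xi)=\nabla^2_\xi\ell_n(\xi)$ and, with $g_\xi(x)=\log h_\theta(x)+\nu$ for $\xi=(\theta,\nu)$, $$v(\xi)=\frac1n\sum_{i=1}^n\nabla_\xi g_\xi(y_i)\frac{\exp\{g_\xi(y_i)\}}{h_\psi(y_i)}-\mathbb{E}_\psi\left[\nabla_\xi g_\xi(X)\left(\frac{\exp\{g_\xi(X)\}}{h_\psi(X)}\right)^2\right].$$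
   Context: Setting. $\Theta$ is an open subset of $\mathbb{R}^d$, $\mathcal{X}\subset\mathbb{R}^k$, $\mu$ is a measure on $\mathcal{X}$, and for each $\theta\in\Theta$, $h_\theta\ge0$ is a measurable function on $\mathcal{X}$ with $\mathcal{Z}(\theta)=\int_{\mathcal{X}}h_\theta(x)\,\mu(\mathrm{d}x)\in(0,\infty)$. $\mathbb{P}_\theta$ is the probability with density $f_\theta=h_\theta/\mathcal{Z}(\theta)$ with respect to $\mu$; the model is identifiable. $\mathbb{P}_\psi$ is a probability with density $f_\psi=h_\psi/\mathcal{Z}(\psi)$ with respect to $\mu$ (where $h_\psi\geq 0$ and $\mathcal{Z}(\psi)=\int h_\psi\,\mathrm{d}\mu\in(0,\infty)$); it need not belong to the model, but $\mathbb{P}_\theta\ll\mathbb{P}_\psi$ for every $\theta\in\Theta$. $\mathbb{E}_\psi$ denotes expectation under $X\sim\mathbb{P}_\psi$. The points $y_1,\dots,y_n\in\mathcal{X}$ satisfy $h_\psi(y_i)>0$. $B(\theta,\varepsilon)$ is the open ball of centre $\theta$ and radius $\varepsilon$. A process $(X_j)_{j\ge1}$ is $\mathbb{P}_\psi$-ergodic if $\frac1m\sum_{j=1}^m\varphi(X_j)\to\mathbb{E}_\psi[\varphi(X)]$ almost surely as $m\to\infty$ for every measurable real-valued $\varphi$ with $\mathbb{E}_\psi|\varphi(X)|<\infty$. Write $\xi=(\theta,\nu)\in\Xi=\Theta\times\mathbb{R}$. Define $$\ell^{\mathrm{NCE}}_{n,m}(\theta,\nu)=\sum_{i=1}^n\log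 q_{\theta,\nu}(y_i)+\sum_{j=1}^m\log\{1-q_{\theta,\nu}(X_j)\},\qquad \log\frac{q_{\theta,\nu}(x)}{1-q_{\theta,\nu}(x)}=\log\frac{h_\theta(x)}{h_\psi(x)}+\nu+\log\frac nm,$$ $$\ell^{\mathrm{IS}}_{n,m}(\theta,\nu)=\frac1n\sum_{i=1}^n\log\frac{h_\theta(y_i)}{h_\psi(y_i)}+\nu-\frac{e^\nu}{m}\sum_{j=1}^m\frac{h_\theta(X_j)}{h_\psi(X_j)},$$ $$\ell_n(\theta,\nu)=\frac1n\sum_{i=1}^n\log\frac{h_\theta(y_i)}{h_\psi(y_i)}+\nu-e^{\nu}\frac{\mathcal{Z}(\theta)}{\mathcal{Z}(\psi)},\qquad \ell_n(\theta)=\frac1n\sum_{i=1}^n\log h_\theta(y_i)-\log\mathcal{Z}(\theta).$$ Here $\ell_n(\xi)$ means $\ell_n(\theta,\nu)$. It is assumed that the MLE exists and is unique, i.e. $\ell_n(\theta,\nu)$ has a unique maximiser $\hat\xi_n=(\hat\theta_n,\hat\nu_n)$ over $\Xi$; equivalently $\hat\theta_n$ is the unique maximiser of $\ell_n(\theta)$ and $\hat\nu_n=\log\{\mathcal{Z}(\psi)/\mathcal{Z}(\hat\theta_n)\}$. $\hat\xi^{\mathrm{IS}}_{n,m}$ (MC-MLE) and $\hat\xi^{\mathrm{NCE}}_{n,m}$ (NCE) are random sequences in $\Xi$, estimators obtained by (approximately) maximising $\ell^{\mathrm{IS}}_{n,m}$ and $\ell^{\mathrm{NCE}}_{n,m}$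 respectively.
   Formalization: (H2) additionally requires that, almost surely, the maps θ↦h_θ(X_j) are twice continuously differentiable in the common neighbourhood of θ̂_n for all j; without it an ergodic process may visit a null point of non-smoothness (e.g. a fixed start X_1) and the limit can fail. *)

theory Defs
  imports "HOL-Probability.Probability" "HOL-Library.Landau_Symbols"
begin

section \<open>Gradient and Hessian\<close>

definition gradient :: "('a::euclidean_space \<Rightarrow> real) \<Rightarrow> 'a \<Rightarrow> 'a" where
  "gradient f x = (THE D. GDERIV f x :> D)"

text \<open>The Hessian matrix is represented by the corresponding linear operator, so its norm is the
  operator norm, and this also applies to functions on the product space of pairs
  \<open>(\<theta>, \<nu>)\<close>.\<close>

definition hessian :: "('a::euclidean_space \<Rightarrow> real) \<Rightarrow> 'a \<Rightarrow> ('a \<Rightarrow>\<^sub>L 'a)" where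
  "hessian f x = Blinfun (frechet_derivative (gradient f) (at x))"

definition C2_on :: "'a::euclidean_space set \<Rightarrow> ('a \<Rightarrow> real) \<Rightarrow> bool" where
  "C2_on U f \<longleftrightarrow>
     (\<forall>x\<in>U. f differentiable (at x)) \<and>
     (\<forall>x\<in>U. gradient f differentiable (at x)) \<and>
     continuous_on U (hessian f)"


section \<open>Unnormalised models\<close>

definition norm_const :: "'b measure \<Rightarrow> ('b \<Rightarrow> real) \<Rightarrow> real" where
  "norm_const \<mu> f = (\<integral>x. f x \<partial>\<mu>)"

definition unnorm_prob :: "'b measure \<Rightarrow> ('b \<Rightarrow> real) \<Rightarrow> 'b measure" where
  "unnorm_prob \<mu> f = density \<mu> (\<lambda>x. ennreal (f x / norm_const \<mu> f))"

text \<open>Expectations are taken with respect to the completed measure: an integrand such as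
  \<open>\<nabla> log h\<close> may be defined only up to a null set, and the Bochner integral of a function that is
  not measurable would be 0. For measurable integrands the completion makes no difference.\<close>

definition expect :: "'b measure \<Rightarrow> ('b \<Rightarrow> 'c::euclidean_space) \<Rightarrow> 'c" where
  "expect P f = (\<integral>x. f x \<partial>(completion P))"

definition ergodic_process ::
    "'w measure \<Rightarrow> 'b measure \<Rightarrow> (nat \<Rightarrow> 'w \<Rightarrow> 'b) \<Rightarrow> bool" where
  "ergodic_process M P X \<longleftrightarrow>
     (\<forall>\<phi> :: 'b \<Rightarrow> real. integrable P \<phi> \<longrightarrow>
        (AE \<omega> in M. (\<lambda>m. (\<Sum>j=1..m. \<phi> (X j \<omega>)) / real m) \<longlonglongrightarrow> (\<integral>x. \<phi> x \<partial>P)))"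


section \<open>Objective functions\<close>

text \<open>Throughout, \<open>h \<theta> x\<close> is the unnormalised density, \<open>h\<psi>\<close> the unnormalised
  density of the artificial data, \<open>y 1, \<dots>, y n\<close> the observed data, and \<open>X 1, X 2, \<dots>\<close>
  the artificial data (for one realisation).\<close>

definition loglik_theta ::
    "'b measure \<Rightarrow> ('p \<Rightarrow> 'b \<Rightarrow> real) \<Rightarrow> nat \<Rightarrow> (nat \<Rightarrow> 'b) \<Rightarrow> 'p \<Rightarrow> real" where
  "loglik_theta \<mu> h n y \<theta> = (1 / n) * (\<Sum>i=1..n. ln (h \<theta> (y i))) - ln (norm_const \<mu> (h \<theta>))"

definition loglik ::
    "'b measure \<Rightarrow> ('p \<Rightarrow> 'b \<Rightarrow> real) \<Rightarrow> ('b \<Rightarrow> real) \<Rightarrow> nat \<Rightarrow> (nat \<Rightarrow> 'b) \<Rightarrow> 'p \<times> real \<Rightarrow> real" where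
  "loglik \<mu> h h\<psi> n y = (\<lambda>(\<theta>, \<nu>).
     (1 / n) * (\<Sum>i=1..n. ln (h \<theta> (y i) / h\<psi> (y i))) + \<nu>
       - exp \<nu> * (norm_const \<mu> (h \<theta>) / norm_const \<mu> h\<psi>))"

text \<open>The real logarithm has \<open>ln 0 = 0\<close>. For maximisation the convention
  \<open>log 0 = -\<infinity>\<close> is restored: a parameter that gives some observation density 0 has
  log-likelihood \<open>-\<infinity>\<close>.\<close>

definition ext_loglik ::
    "'b measure \<Rightarrow> ('p \<Rightarrow> 'b \<Rightarrow> real) \<Rightarrow> ('b \<Rightarrow> real) \<Rightarrow> nat \<Rightarrow> (nat \<Rightarrow> 'b) \<Rightarrow> 'p \<times> real \<Rightarrow> ereal" where
  "ext_loglik \<mu> h h\<psi> n y \<xi> =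
     (if \<forall>i\<in>{1..n}. 0 < h (fst \<xi>) (y i) then ereal (loglik \<mu> h h\<psi> n y \<xi>) else -\<infinity>)"

definition unique_argmax :: "('a \<Rightarrow> ereal) \<Rightarrow> 'a set \<Rightarrow> 'a \<Rightarrow> bool" where
  "unique_argmax f S x \<longleftrightarrow> {z. is_arg_max f (\<lambda>z. z \<in> S) z} = {x}"

definition loglik_IS ::
    "('p \<Rightarrow> 'b \<Rightarrow> real) \<Rightarrow> ('b \<Rightarrow> real) \<Rightarrow> nat \<Rightarrow> (nat \<Rightarrow> 'b) \<Rightarrow> nat \<Rightarrow> (nat \<Rightarrow> 'b) \<Rightarrow> 'p \<times> real \<Rightarrow> real" where
  "loglik_IS h h\<psi> n y m X = (\<lambda>(\<theta>, \<nu>).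
     (1 / n) * (\<Sum>i=1..n. ln (h \<theta> (y i) / h\<psi> (y i))) + \<nu>
       - (exp \<nu> / m) * (\<Sum>j=1..m. h \<theta> (X j) / h\<psi> (X j)))"

text \<open>The classification probability \<open>q\<close> is defined from its odds rather than its log-odds, so
  that \<open>q = 0\<close> where \<open>h \<theta> x = 0\<close> (log-odds \<open>-\<infinity>\<close>). Where both densities are positive the
  lemma below gives the logit equation.\<close>

definition nce_odds ::
    "('p \<Rightarrow> 'b \<Rightarrow> real) \<Rightarrow> ('b \<Rightarrow> real) \<Rightarrow> nat \<Rightarrow> nat \<Rightarrow> 'p \<times> real \<Rightarrow> 'b \<Rightarrow> real" where
  "nce_odds h h\<psi> n m = (\<lambda>(\<theta>, \<nu>) x. (h \<theta> x / h\<psi> x) * exp \<nu> * (real n / real m))"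

definition nce_q ::
    "('p \<Rightarrow> 'b \<Rightarrow> real) \<Rightarrow> ('b \<Rightarrow> real) \<Rightarrow> nat \<Rightarrow> nat \<Rightarrow> 'p \<times> real \<Rightarrow> 'b \<Rightarrow> real" where
  "nce_q h h\<psi> n m \<xi> x = nce_odds h h\<psi> n m \<xi> x / (1 + nce_odds h h\<psi> n m \<xi> x)"

lemma logit_nce_q:
  assumes "0 < h \<theta> x" "0 < h\<psi> x" "0 < n" "0 < m"
  shows "ln (nce_q h h\<psi> n m (\<theta>, \<nu>) x / (1 - nce_q h h\<psi> n m (\<theta>, \<nu>) x))
           = ln (h \<theta> x / h\<psi> x) + \<nu> + ln (real n / real m)"
proof -
  define r where "r = nce_odds h h\<psi> n m (\<theta>, \<nu>) x"
  have r: "r = (h \<theta> x / h\<psi> x) * exp \<nu> * (real n / real m)"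
    by (simp add: r_def nce_odds_def)
  have "r > 0"
    using assms by (simp add: r)
  then have "nce_q h h\<psi> n m (\<theta>, \<nu>) x / (1 - nce_q h h\<psi> n m (\<theta>, \<nu>) x) = r"
    by (simp add: nce_q_def flip: r_def) (simp add: field_simps)
  moreover have "ln r = ln (h \<theta> x / h\<psi> x) + \<nu> + ln (real n / real m)"
  proof -
    have a: "0 < h \<theta> x / h\<psi> x" and b: "0 < real n / real m"
      using assms by simp_all
    show ?thesis
      using ln_mult_pos[OF mult_pos_pos[OF a exp_gt_zero] b] ln_mult_pos[OF a exp_gt_zero]
      unfolding r by (simp only: ln_exp)
  qed
  ultimately show ?thesis by simp
qed

definition loglik_NCE ::
    "('p \<Rightarrow> 'b \<Rightarrow> real) \<Rightarrow> ('b \<Rightarrow> real) \<Rightarrow> nat \<Rightarrow> (nat \<Rightarrow> 'b) \<Rightarrow> nat \<Rightarrow> (nat \<Rightarrow> 'b) \<Rightarrow> 'p \<times> real \<Rightarrow> real" where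
  "loglik_NCE h h\<psi> n y m X \<xi> =
     (\<Sum>i=1..n. ln (nce_q h h\<psi> n m \<xi> (y i))) + (\<Sum>j=1..m. ln (1 - nce_q h h\<psi> n m \<xi> (X j)))"


section \<open>Envelopes and the limit vector\<close>

text \<open>The suprema are extended-valued, so that an unbounded supremum is infinite. At parameters
  with \<open>h \<theta> x = 0\<close> the derivatives of \<open>log h\<close> are those of \<open>ln \<circ> h\<close> under \<open>ln 0 = 0\<close>. This is
  harmless: if \<open>h\<close> is smooth in \<open>\<theta>\<close> on the ball and vanishes at some but not all of its points,
  then the gradient of \<open>log h\<close> is unbounded on the part where \<open>h\<close> is positive, so the supremum is
  infinite; if \<open>h\<close> vanishes on the whole ball, the derivatives are 0 and the envelopes are
  multiplied by 0.\<close>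

definition sup_ball :: "'a::metric_space \<Rightarrow> real \<Rightarrow> ('a \<Rightarrow> real) \<Rightarrow> ennreal" where
  "sup_ball c \<epsilon> f = (SUP \<theta>\<in>ball c \<epsilon>. ennreal (f \<theta>))"

definition env_a ::
    "('p::euclidean_space \<Rightarrow> 'b \<Rightarrow> real) \<Rightarrow> 'p \<Rightarrow> real \<Rightarrow> 'b \<Rightarrow> ennreal" where
  "env_a h c \<epsilon> x =
     1 + sup_ball c \<epsilon> (\<lambda>\<theta>. (norm (gradient (\<lambda>t. ln (h t x)) \<theta>))\<^sup>2)
       + sup_ball c \<epsilon> (\<lambda>\<theta>. norm (hessian (\<lambda>t. ln (h t x)) \<theta>))"

definition env_b ::
    "('p::euclidean_space \<Rightarrow> 'b \<Rightarrow> real) \<Rightarrow> 'p \<Rightarrow> real \<Rightarrow> 'b \<Rightarrow> ennreal" where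
  "env_b h c \<epsilon> x = 1 + sup_ball c \<epsilon> (\<lambda>\<theta>. norm (gradient (\<lambda>t. ln (h t x)) \<theta>))"

definition g_fun :: "('p \<Rightarrow> 'b \<Rightarrow> real) \<Rightarrow> 'p \<times> real \<Rightarrow> 'b \<Rightarrow> real" where
  "g_fun h \<xi> x = ln (h (fst \<xi>) x) + snd \<xi>"

text \<open>\<open>exp {g}\<close>, with value 0 where \<open>h \<theta> x = 0\<close> (that is, \<open>g = -\<infinity>\<close>).\<close>

definition exp_g :: "('p \<Rightarrow> 'b \<Rightarrow> real) \<Rightarrow> 'p \<times> real \<Rightarrow> 'b \<Rightarrow> real" where
  "exp_g h \<xi> x = h (fst \<xi>) x * exp (snd \<xi>)"

lemma exp_g_eq: "0 < h (fst \<xi>) x \<Longrightarrow> exp_g h \<xi> x = exp (g_fun h \<xi> x)"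
  by (simp add: exp_g_def g_fun_def exp_add)

definition v_vec ::
    "'b measure \<Rightarrow> ('p::euclidean_space \<Rightarrow> 'b \<Rightarrow> real) \<Rightarrow> ('b \<Rightarrow> real) \<Rightarrow> nat \<Rightarrow> (nat \<Rightarrow> 'b) \<Rightarrow>
      'p \<times> real \<Rightarrow> 'p \<times> real" where
  "v_vec \<mu> h h\<psi> n y \<xi> =
     (1 / real n) *\<^sub>R (\<Sum>i=1..n. (exp_g h \<xi> (y i) / h\<psi> (y i)) *\<^sub>R gradient (\<lambda>z. g_fun h z (y i)) \<xi>)
     - expect (unnorm_prob \<mu> h\<psi>)
         (\<lambda>x. ((exp_g h \<xi> x / h\<psi> x)\<^sup>2) *\<^sub>R gradient (\<lambda>z. g_fun h z x) \<xi>)"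

end

theory Submission
  imports Defs
begin

text \<open>
Write \<open>r\<^sub>t(x) = h\<^sub>t(x) / h\<^sub>\<psi>(x)\<close>. Let \<open>T\<^sub>m\<close> be the gradient of the importance sampling objective and \<open>N\<^sub>m\<close> that
of the noise-contrastive one. The proof compares the two gradients at the same point. At a parameter
\<open>\<xi> = (t, \<nu>)\<close> the identity
\<open>T\<^sub>m(\<xi>) - N\<^sub>m(\<xi>) / n = (n / m) b\<^sub>m(\<xi>)\<close> is exact (\<open>score_minus_NCE_gradient\<close>), because the logistic weight
\<open>1 / (1 + o)\<close> of a data point differs from 1 by \<open>o / (1 + o)\<close> and the odds \<open>o\<close> carry the factor \<open>n / m\<close>.
Along a sequence \<open>\<xi>\<^sub>m\<close> that tends to the maximum likelihood estimator, \<open>b\<^sub>m(\<xi>\<^sub>m)\<close> tends to the vector \<open>v\<close>: the remaining odds in its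
denominators vanish, and its sum over the artificial points is an ergodic average. Both estimators are zeros
of their gradients up to \<open>o(1 / m)\<close>, so \<open>m (T\<^sub>m(\<xi>\<^sup>I\<^sup>S) - T\<^sub>m(\<xi>\<^sup>N\<^sup>C\<^sup>E))\<close> tends to \<open>- n v\<close>. The derivative of \<open>T\<^sub>m\<close> converges, uniformly
near the maximum likelihood estimator, to the Hessian of \<open>\<ell>\<^sub>n(\<theta>, \<nu>)\<close> there, and inverting that Hessian gives the limit of
\<open>m (\<xi>\<^sup>I\<^sup>S - \<xi>\<^sup>N\<^sup>C\<^sup>E)\<close> (\<open>tendsto_scaled_difference\<close>). All this is done for one realisation of the artificial
data, in \<open>estimator_difference_limit\<close>.

The probabilistic input is that the averages of \<open>r\<^sub>t\<close>, its first two derivatives, and the damped products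
\<open>r\<^sub>t (\<nabla>r\<^sub>t, r\<^sub>t) / (1 + \<tau> r\<^sub>t)\<close> converge to their expectations uniformly near the limiting parameter
(\<open>uniform_ergodic_average\<close>): by dominated convergence the expected oscillation over a small ball is small,
and the oscillation is itself a function to which ergodicity applies. Ergodicity concerns functions that are
measurable everywhere, whereas smoothness in the parameter may fail on a null set that the artificial
points are still free to visit wherever \<open>h\<close> happens to be smooth. Changing functions on null sets is
therefore forbidden. Derivatives are instead replaced by limits of difference quotients
(\<open>measurable_derivative\<close>) and suprema by suprema over countable dense sets (\<open>measurable_sup\<close>); these are measurable
everywhere and correct at every point of smoothness.

The integrability assumptions bound derivatives of \<open>log h\<close>, while the averages involve derivatives of \<open>h\<close>.
The passage between the two rests on a dichotomy (\<open>envelope_cases\<close>): if \<open>\<nabla> log h\<close> is bounded where \<open>h\<close> is positive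
in a ball, then \<open>h\<close> is either positive on the whole ball or zero on the whole ball.

Finally, differentiation under the integral identifies the limit of the derivatives of \<open>T\<^sub>m\<close> with the
Hessian on the product space. At the maximiser \<open>e\<^sup>\<nu> \<Z>(\<theta>) / \<Z>(\<psi>) = 1\<close>, and the Schur complement of the lower right entry \<open>-1\<close>
of that Hessian is the Hessian of \<open>\<ell>\<^sub>n(\<theta>)\<close>, so that invertibility of the latter suffices (\<open>bij_score_deriv\<close>).
\<close>

section \<open>Gradients and Hessians\<close>

lemma gradient_eqI:
  fixes f :: "'a::euclidean_space \<Rightarrow> real"
  assumes "(f has_derivative (\<lambda>d. D \<bullet> d)) (at x)"
  shows "gradient f x = D"
  unfolding gradient_def
proof (rule the_equality)
  show "GDERIV f x :> D"
    using assms by (simp add: gderiv_def inner_commute)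
  fix D' assume "GDERIV f x :> D'"
  then have "(\<lambda>d. D' \<bullet> d) = (\<lambda>d. D \<bullet> d)"
    using has_derivative_unique[OF _ assms] by (simp add: gderiv_def inner_commute)
  then show "D' = D" 
    by (metis vector_eq_rdot)
qed

lemma has_derivative_gradient:
  fixes f :: "'a::euclidean_space \<Rightarrow> real"
  assumes "f differentiable (at x)"
  shows "(f has_derivative (\<lambda>d. gradient f x \<bullet> d)) (at x)"
proof -
  obtain F where F: "(f has_derivative F) (at x)"
    using assms by (auto simp: differentiable_def)
  interpret F: bounded_linear F using F by (rule has_derivative_bounded_linear)
  have "F = (\<lambda>d. (\<Sum>b\<in>Basis. F b *\<^sub>R b) \<bullet> d)"
  proof
    fix d
    have "F d = F (\<Sum>b\<in>Basis. (d \<bullet> b) *\<^sub>R b)" by (simp add: euclidean_representation)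
    also have "\<dots> = (\<Sum>b\<in>Basis. F b *\<^sub>R b) \<bullet> d"
      by (simp add: F.sum F.scaleR inner_sum_left inner_commute[of d] mult.commute)
    finally show "F d = (\<Sum>b\<in>Basis. F b *\<^sub>R b) \<bullet> d" .
  qed
  then show ?thesis using F gradient_eqI by metis
qed

lemma hessian_eqI:
  fixes f :: "'a::euclidean_space \<Rightarrow> real"
  assumes "open S" "x \<in> S" "\<And>z. z \<in> S \<Longrightarrow> (f has_derivative (\<lambda>d. G z \<bullet> d)) (at z)"
    and K: "(G has_derivative K) (at x)"
  shows "blinfun_apply (hessian f x) = K"
proof -
  have "(gradient f has_derivative K) (at x)"
    using has_derivative_transform_within_open[OF K assms(1,2)] gradient_eqI[OF assms(3)] by metis
  then show ?thesis
    using frechet_derivative_at[of "gradient f" K x] has_derivative_bounded_linear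
    by (metis bounded_linear_Blinfun_apply hessian_def)
qed

lemma C2_on_has_derivative:
  assumes "C2_on U f" "x \<in> U"
  shows "(f has_derivative (\<lambda>d. gradient f x \<bullet> d)) (at x)"
    and "(gradient f has_derivative blinfun_apply (hessian f x)) (at x)"
proof -
  show "(f has_derivative (\<lambda>d. gradient f x \<bullet> d)) (at x)"
    using assms by (auto simp: C2_on_def intro: has_derivative_gradient)
  have "(gradient f has_derivative frechet_derivative (gradient f) (at x)) (at x)"
    using assms by (auto simp: C2_on_def simp flip: frechet_derivative_works)
  then show "(gradient f has_derivative blinfun_apply (hessian f x)) (at x)"
    unfolding hessian_def using has_derivative_bounded_linear bounded_linear_Blinfun_apply by metis
qed

lemma C2_on_continuous:
  assumes "C2_on U f"
  shows "continuous_on U f" "continuous_on U (gradient f)" "continuous_on U (\<lambda>x. blinfun_apply (hessian f x) d)"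
proof -
  show "continuous_on U f" 
    using C2_on_has_derivative(1)[OF assms] by (meson continuous_at_imp_continuous_on has_derivative_continuous)
  show "continuous_on U (gradient f)" 
    using C2_on_has_derivative(2)[OF assms] by (meson continuous_at_imp_continuous_on has_derivative_continuous)
  show "continuous_on U (\<lambda>x. blinfun_apply (hessian f x) d)"
    using assms by (auto simp: C2_on_def intro!: continuous_intros)
qed

lemma C2_on_subset: "C2_on U f \<Longrightarrow> V \<subseteq> U \<Longrightarrow> C2_on V f"
  unfolding C2_on_def by (blast intro: continuous_on_subset)

lemma has_derivative_gradient_ln:
  assumes "(f has_derivative (\<lambda>d. g \<bullet> d)) (at x)" "0 < f x"
  shows "((\<lambda>t. ln (f t)) has_derivative (\<lambda>d. (g /\<^sub>R f x) \<bullet> d)) (at x)"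
  using assms by (auto intro!: derivative_eq_intros simp: field_simps inner_commute)

lemma has_derivative_scaled_gradient:
  assumes "(f has_derivative (\<lambda>d. G x \<bullet> d)) (at x)" "(G has_derivative K) (at x)" "0 < f x"
  shows "((\<lambda>t. G t /\<^sub>R f t) has_derivative (\<lambda>d. K d /\<^sub>R f x - ((G x \<bullet> d) / (f x)\<^sup>2) *\<^sub>R G x)) (at x)"
  using assms by (auto intro!: derivative_eq_intros simp: field_simps power2_eq_square)

lemma hessian_ln:
  assumes "C2_on U f" "open U" "\<And>t. t \<in> U \<Longrightarrow> 0 < f t" "x \<in> U"
  shows "blinfun_apply (hessian (\<lambda>t. ln (f t)) x) d
    = hessian f x d /\<^sub>R f x - ((gradient f x \<bullet> d) / (f x)\<^sup>2) *\<^sub>R gradient f x"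
  by (subst hessian_eqI[OF assms(2,4) has_derivative_gradient_ln has_derivative_scaled_gradient])
     (use assms C2_on_has_derivative in auto)

section \<open>Pointwise bounds from the envelopes\<close>

text \<open>At a zero in \<open>S\<close> the function \<open>f\<close> has a minimum, so its gradient vanishes there and the bound
\<open>norm (G x) \<le> L * f x\<close> holds on all of \<open>S\<close>. Along the segment from \<open>a\<close> to \<open>b\<close> the function then satisfies a
differential inequality of Gronwall type with initial value 0.\<close>

lemma zero_of_gradient_le:
  fixes f :: "'a::euclidean_space \<Rightarrow> real"
  assumes S: "open S" "convex S" and a: "a \<in> S" "f a = 0" and b: "b \<in> S"
    and nonneg: "\<And>x. x \<in> S \<Longrightarrow> 0 \<le> f x"
    and deriv: "\<And>x. x \<in> S \<Longrightarrow> (f has_derivative (\<lambda>d. G x \<bullet> d)) (at x)"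
    and bound: "\<And>x. x \<in> S \<Longrightarrow> 0 < f x \<Longrightarrow> norm (G x) \<le> L * f x"
  shows "f b = 0"
proof -
  have le: "norm (G x) \<le> L * f x" if x: "x \<in> S" for x
  proof (cases "f x = 0")
    case True
    have "(\<lambda>d. G x \<bullet> d) = (\<lambda>d. 0)"
      using differential_zero_maxmin[OF x S(1) deriv[OF x]] True nonneg by auto
    then have "G x = 0" by (metis inner_eq_zero_iff)
    then show ?thesis using True by simp
  qed (use bound[OF x] nonneg[OF x] in auto)
  define c where "c = L * norm (b - a)"
  \<comment> \<open>The exponential factor absorbs the growth allowed by the bound, so \<open>\<phi>\<close> cannot increase.\<close>
  define \<phi> where "\<phi> t = f (a + t *\<^sub>R (b - a)) * exp (- (c * t))" for t
  have "\<phi> 0 \<ge> \<phi> 1"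
  proof (rule DERIV_nonpos_imp_nonincreasing[of 0 1 \<phi>])
    fix t :: real assume t: "0 \<le> t" "t \<le> 1"
    let ?x = "a + t *\<^sub>R (b - a)"
    have x: "?x \<in> S"
      using convexD_alt[OF S(2) a(1) b t] by (simp add: algebra_simps)
    have "(f has_derivative (\<lambda>d. G ?x \<bullet> d)) (at ?x)" using deriv x by blast
    then have "((\<lambda>t. f (a + t *\<^sub>R (b - a))) has_derivative (\<lambda>s. G ?x \<bullet> (s *\<^sub>R (b - a)))) (at t)"
      by (rule has_derivative_compose[rotated]) (auto intro!: derivative_eq_intros)
    then have D: "((\<lambda>t. f (a + t *\<^sub>R (b - a))) has_real_derivative (G ?x \<bullet> (b - a))) (at t)"
      by (simp add: has_field_derivative_def mult_commute_abs)
    have E: "((\<lambda>t. exp (- (c * t))) has_real_derivative - c * exp (- (c * t))) (at t)"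
      by (auto intro!: derivative_eq_intros)
    have "(\<phi> has_real_derivative (G ?x \<bullet> (b - a) - c * f ?x) * exp (- (c * t))) (at t)"
      unfolding \<phi>_def by (rule DERIV_cong[OF DERIV_mult[OF D E]]) (simp add: algebra_simps)
    moreover have "G ?x \<bullet> (b - a) \<le> c * f ?x"
      using norm_cauchy_schwarz[of "G ?x" "b - a"] mult_right_mono[OF le[OF x] norm_ge_zero[of "b - a"]]
      by (simp add: c_def mult.commute mult.left_commute)
    ultimately show "\<exists>y. (\<phi> has_real_derivative y) (at t) \<and> y \<le> 0"
      by (smt (verit) exp_gt_zero mult_nonpos_nonneg)
  qed simp
  then have "f b * exp (- c) \<le> 0" using a by (simp add: \<phi>_def)
  then show ?thesis using nonneg[OF b] by (simp add: mult_le_0_iff)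
qed

lemma le_sup_ball: "p \<in> ball c \<epsilon> \<Longrightarrow> ennreal (f p) \<le> sup_ball c \<epsilon> f"
  unfolding sup_ball_def by (rule SUP_upper)

text \<open>If \<open>w\<close> is finite, it is a Lipschitz constant for \<open>ln \<circ> f\<close> where \<open>f\<close> is positive; a finite rate cannot take
\<open>ln \<circ> f\<close> to \<open>-\<infinity>\<close> within the ball, so one zero forces \<open>f\<close> to vanish identically.\<close>

lemma envelope_cases:
  fixes f :: "'a::euclidean_space \<Rightarrow> real"
  assumes deriv: "\<And>x. x \<in> ball c \<epsilon> \<Longrightarrow> (f has_derivative (\<lambda>d. gradient f x \<bullet> d)) (at x)"
    and nonneg: "\<And>x. x \<in> ball c \<epsilon> \<Longrightarrow> 0 \<le> f x"
    and w: "\<And>x. x \<in> ball c \<epsilon> \<Longrightarrow> ennreal (norm (gradient (\<lambda>t. ln (f t)) x)) \<le> w"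
  obtains "\<And>x. x \<in> ball c \<epsilon> \<Longrightarrow> 0 < f x" | "\<And>x. x \<in> ball c \<epsilon> \<Longrightarrow> f x = 0"
  | z where "w = \<top>" "z \<in> ball c \<epsilon>" "0 < f z"
proof (cases "w = \<top> \<or> (\<forall>x\<in>ball c \<epsilon>. 0 < f x)")
  case True
  then show ?thesis using that nonneg by (metis less_eq_real_def)
next
  case False
  then obtain a where a: "a \<in> ball c \<epsilon>" "f a = 0" using nonneg by force
  obtain L where L: "w = ennreal L" "0 \<le> L" using False by (cases w) auto
  have "norm (gradient f x) \<le> L * f x" if "x \<in> ball c \<epsilon>" "0 < f x" for x
    using w[OF that(1)] that(2) L
    by (simp add: gradient_eqI[OF has_derivative_gradient_ln[OF deriv[OF that(1)] that(2)]] field_simps)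
  then have "f x = 0" if "x \<in> ball c \<epsilon>" for x
    using zero_of_gradient_le[OF open_ball convex_ball a that nonneg deriv] by blast
  then show ?thesis using that by blast
qed

lemma C2_on_zero:
  assumes "open S" "x \<in> S" "\<And>z. z \<in> S \<Longrightarrow> f z = 0"
  shows "gradient f x = 0" "blinfun_apply (hessian f x) = (\<lambda>d. 0)"
proof -
  have D: "(f has_derivative (\<lambda>d. 0 \<bullet> d)) (at z)" if "z \<in> S" for z
    by (rule has_derivative_transform_within_open[OF _ assms(1) that, of "\<lambda>_. 0"]) (auto simp: assms(3))
  show "gradient f x = 0" using gradient_eqI[OF D[OF assms(2)]] .
  show "blinfun_apply (hessian f x) = (\<lambda>d. 0)"
    using hessian_eqI[OF assms(1,2) D has_derivative_const] by simp
qed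

text \<open>With \<open>\<nabla>f = f \<nabla>(ln f)\<close> and \<open>\<nabla>\<^sup>2f = f (\<nabla>\<^sup>2(ln f) + \<nabla>(ln f) \<nabla>(ln f)\<^sup>T)\<close> the derivatives of \<open>f\<close> are dominated by the envelope, which is why
the envelope contains the square of the first derivative. The estimates remain true where \<open>f\<close> vanishes: by
\<open>envelope_cases\<close> either all left-hand sides are 0 or the right-hand sides are infinite (0 when \<open>d = 0\<close>).\<close>

lemma env_a_bounds:
  fixes h :: "'p::euclidean_space \<Rightarrow> 'b \<Rightarrow> real"
  defines "f \<equiv> \<lambda>x t. h t x"
  assumes C2: "C2_on (ball c \<epsilon>) (f x)" and nonneg: "\<And>t. t \<in> ball c \<epsilon> \<Longrightarrow> 0 \<le> f x t"
    and p: "p \<in> ball c \<epsilon>"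
  shows "ennreal (f x p) \<le> env_a h c \<epsilon> x * sup_ball c \<epsilon> (f x)" (is "_ \<le> ?w * ?s")
    and "ennreal (norm (gradient (f x) p)) \<le> env_a h c \<epsilon> x * sup_ball c \<epsilon> (f x)"
    and "ennreal (norm (blinfun_apply (hessian (f x) p) d)) \<le> env_a h c \<epsilon> x * sup_ball c \<epsilon> (f x) * ennreal (norm d)"
proof -
  note D = C2_on_has_derivative[OF C2]
  let ?gl = "gradient (\<lambda>t. ln (f x t))" and ?hl = "hessian (\<lambda>t. ln (f x t))"
  have env: "ennreal (1 + (norm (?gl t))\<^sup>2 + norm (?hl t)) \<le> ?w" if "t \<in> ball c \<epsilon>" for t
    unfolding env_a_def f_def
    by (subst ennreal_plus; simp?)+ (intro add_mono order_refl le_sup_ball that)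
  have w: "ennreal (norm (?gl t)) \<le> ?w" if "t \<in> ball c \<epsilon>" for t
  proof -
    have "norm (?gl t) \<le> 1 + (norm (?gl t))\<^sup>2 + norm (?hl t)"
      using sum_squares_bound[of 1 "norm (?gl t)"] norm_ge_zero[of "?gl t"] norm_ge_zero[of "?hl t"]
      unfolding mult_1_right one_power2 by linarith
    then show ?thesis using env[OF that] by (meson ennreal_leI order_trans)
  qed
  have s: "ennreal (f x p) \<le> ?s" by (rule le_sup_ball[OF p])
  consider "\<And>t. t \<in> ball c \<epsilon> \<Longrightarrow> 0 < f x t" | "\<And>t. t \<in> ball c \<epsilon> \<Longrightarrow> f x t = 0"
    | z where "?w = \<top>" "z \<in> ball c \<epsilon>" "0 < f x z"
    using envelope_cases[OF D(1) nonneg w] by blast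
  then have "ennreal (f x p) \<le> ?w * ?s \<and> ennreal (norm (gradient (f x) p)) \<le> ?w * ?s \<and>
      ennreal (norm (blinfun_apply (hessian (f x) p) d)) \<le> ?w * ?s * ennreal (norm d)"
  proof cases
    case 1
    let ?a = "1 + (norm (?gl p))\<^sup>2 + norm (?hl p)"
    have pos: "0 < f x p" using 1 p .
    have "ennreal (?a * f x p) = ennreal ?a * ennreal (f x p)"
      by (rule ennreal_mult) (use pos in auto)
    also have "\<dots> \<le> ?w * ?s" by (rule mult_mono[OF env[OF p] s]) simp_all
    finally have *: "ennreal (?a * f x p) \<le> ?w * ?s" .
    have gl: "gradient (f x) p = f x p *\<^sub>R ?gl p"
      using pos by (simp add: gradient_eqI[OF has_derivative_gradient_ln[OF D(1)[OF p] pos]])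
    have hl: "blinfun_apply (hessian (f x) p) d = f x p *\<^sub>R (?hl p d + (?gl p \<bullet> d) *\<^sub>R ?gl p)"
      using pos hessian_ln[OF C2 open_ball 1 p, of d] unfolding gl
      by (simp add: algebra_simps power2_eq_square)
    have "norm (?hl p d + (?gl p \<bullet> d) *\<^sub>R ?gl p) \<le> norm (?hl p) * norm d + (norm (?gl p) * norm d) * norm (?gl p)"
      by (rule norm_triangle_le)
         (auto intro!: add_mono norm_blinfun mult_right_mono Cauchy_Schwarz_ineq2)
    also have "\<dots> \<le> ?a * norm d"
      by (simp add: algebra_simps power2_eq_square)
    finally have "norm (blinfun_apply (hessian (f x) p) d) \<le> (?a * f x p) * norm d"
      unfolding hl using mult_left_mono[of _ _ "f x p"] pos by (simp add: mult_ac)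
    then have "ennreal (norm (blinfun_apply (hessian (f x) p) d)) \<le> ennreal (?a * f x p) * ennreal (norm d)"
      by (subst ennreal_mult''[symmetric]) (auto intro: ennreal_leI)
    also have "\<dots> \<le> ?w * ?s * ennreal (norm d)" by (rule mult_right_mono[OF *]) simp
    finally have 3: "ennreal (norm (blinfun_apply (hessian (f x) p) d)) \<le> ?w * ?s * ennreal (norm d)" .
    have "norm (?gl p) \<le> ?a" 
      using sum_squares_bound[of 1 "norm (?gl p)"] norm_ge_zero[of "?gl p"] norm_ge_zero[of "?hl p"]
      unfolding mult_1_right one_power2 by linarith
    then have "norm (gradient (f x) p) \<le> ?a * f x p"
      unfolding gl using mult_right_mono[of _ _ "f x p"] pos by (simp add: mult_ac)
    moreover have "f x p \<le> ?a * f x p" using pos by (simp add: algebra_simps)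
    ultimately show ?thesis using 3 * by (meson ennreal_leI order_trans)
  next
    case 2
    then show ?thesis using C2_on_zero[OF open_ball p 2] p by simp
  next
    case 3
    have "?s \<noteq> 0" using 3 le_sup_ball[OF 3(2), of "f x"] by auto
    then show ?thesis using 3 by (cases "d = 0") (auto simp: ennreal_top_mult ennreal_mult_top)
  qed
  then show "ennreal (f x p) \<le> ?w * ?s" "ennreal (norm (gradient (f x) p)) \<le> ?w * ?s"
      "ennreal (norm (blinfun_apply (hessian (f x) p) d)) \<le> ?w * ?s * ennreal (norm d)" by auto
qed

text \<open>The left-hand side is \<open>(f / k)\<^sup>2 (1 + \<parallel>\<nabla>(ln f)\<parallel>)\<close> wherever \<open>f\<close> is positive. It bounds the norm of \<open>r (\<nabla>r, r)\<close> for \<open>r = f / k\<close>.\<close>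

lemma env_b_bound:
  fixes h :: "'p::euclidean_space \<Rightarrow> 'b \<Rightarrow> real"
  defines "f \<equiv> \<lambda>x t. h t x"
  assumes C2: "C2_on (ball c \<epsilon>) (f x)" and nonneg: "\<And>t. t \<in> ball c \<epsilon> \<Longrightarrow> 0 \<le> f x t"
    and p: "p \<in> ball c \<epsilon>" and k: "0 \<le> k"
  shows "ennreal ((f x p / k) * (norm (gradient (f x) p) / k) + (f x p / k)\<^sup>2) 
    \<le> env_b h c \<epsilon> x * sup_ball c \<epsilon> (\<lambda>t. (f x t / k)\<^sup>2)" (is "_ \<le> ?w * ?s")
proof (cases "k = 0")
  case False
  then have k: "0 < k" using k by simp
  note D = C2_on_has_derivative[OF C2]
  let ?gl = "gradient (\<lambda>t. ln (f x t))"
  have env: "ennreal (1 + norm (?gl t)) \<le> ?w" if "t \<in> ball c \<epsilon>" for t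
    unfolding env_b_def f_def
    by (subst ennreal_plus; simp?)+ (intro add_mono order_refl le_sup_ball that)
  have w: "ennreal (norm (?gl t)) \<le> ?w" if "t \<in> ball c \<epsilon>" for t
    using env[OF that] by (meson ennreal_leI order_trans le_add_same_cancel2 zero_le_one)
  have s: "ennreal ((f x p / k)\<^sup>2) \<le> ?s" by (rule le_sup_ball[OF p])
  consider "\<And>t. t \<in> ball c \<epsilon> \<Longrightarrow> 0 < f x t" | "\<And>t. t \<in> ball c \<epsilon> \<Longrightarrow> f x t = 0"
    | z where "?w = \<top>" "z \<in> ball c \<epsilon>" "0 < f x z"
    using envelope_cases[OF D(1) nonneg w] by blast
  then show ?thesis
  proof cases
    case 1
    have pos: "0 < f x p" using 1 p .
    have "ennreal ((1 + norm (?gl p)) * (f x p / k)\<^sup>2) = ennreal (1 + norm (?gl p)) * ennreal ((f x p / k)\<^sup>2)"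
      by (rule ennreal_mult) (use pos in auto)
    also have "\<dots> \<le> ?w * ?s" by (rule mult_mono[OF env[OF p] s]) simp_all
    finally have *: "ennreal ((1 + norm (?gl p)) * (f x p / k)\<^sup>2) \<le> ?w * ?s" .
    have gl: "gradient (f x) p = f x p *\<^sub>R ?gl p"
      using pos by (simp add: gradient_eqI[OF has_derivative_gradient_ln[OF D(1)[OF p] pos]])
    have "(f x p / k) * (norm (gradient (f x) p) / k) + (f x p / k)\<^sup>2 = (1 + norm (?gl p)) * (f x p / k)\<^sup>2"
      unfolding gl using pos k by (simp add: field_simps power2_eq_square)
    then show ?thesis using * by simp
  next
    case 2
    then show ?thesis using p by simp
  next
    case 3
    have "?s \<noteq> 0" using 3 k le_sup_ball[OF 3(2), of "\<lambda>t. (f x t / k)\<^sup>2"] by (auto simp: ennreal_eq_0_iff)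
    then show ?thesis using 3 by (simp add: ennreal_top_mult)
  qed
qed simp

lemma sup_ball_mono: "\<delta> \<le> \<epsilon> \<Longrightarrow> sup_ball c \<delta> f \<le> sup_ball c \<epsilon> f"
  unfolding sup_ball_def by (rule SUP_subset_mono) auto

lemma env_mono:
  assumes "\<delta> \<le> \<epsilon>"
  shows "env_a h c \<delta> x \<le> env_a h c \<epsilon> x" "env_b h c \<delta> x \<le> env_b h c \<epsilon> x"
  unfolding env_a_def env_b_def by (intro add_mono order_refl sup_ball_mono assms)+

section \<open>Measurable derivatives and differentiation under the integral\<close>

text \<open>For each direction the limit of difference quotients along \<open>1 / k\<close> is a measurable function of \<open>x\<close>, including those
\<open>x\<close> at which it does not exist. Combining the basis directions linearly makes \<open>g\<close> linear
at every \<open>x\<close>, and it is the derivative wherever there is one.\<close>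

lemma measurable_derivative:
  fixes f :: "'p::euclidean_space \<Rightarrow> 'x \<Rightarrow> 'e::euclidean_space"
  assumes S: "open S" and meas: "\<And>p. p \<in> S \<Longrightarrow> f p \<in> borel_measurable M"
  obtains g where "\<And>p d. p \<in> S \<Longrightarrow> g p d \<in> borel_measurable M"
    and "\<And>p x. linear (\<lambda>d. g p d x)"
    and "\<And>x p D. p \<in> S \<Longrightarrow> ((\<lambda>q. f q x) has_derivative D) (at p) \<Longrightarrow> (\<lambda>d. g p d x) = D"
proof -
  \<comment> \<open>Difference quotients may leave \<open>S\<close> at first; extension by 0 keeps them measurable.\<close>
  define F where "F p x = (if p \<in> S then f p x else 0)" for p x
  define q where "q p b x = lim (\<lambda>k. real (Suc k) *\<^sub>R (F (p + (1 / real (Suc k)) *\<^sub>R b) x - F p x))" for p b x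
  define g where "g p d x = (\<Sum>b\<in>Basis. (d \<bullet> b) *\<^sub>R q p b x)" for p d x
  have F: "F p \<in> borel_measurable M" for p
    by (cases "p \<in> S") (auto simp: F_def[abs_def] meas)
  have q: "q p b \<in> borel_measurable M" for p b
    unfolding q_def[abs_def] using F by measurable
  have qD: "q p b x = D b" if p: "p \<in> S" and D: "((\<lambda>q. f q x) has_derivative D) (at p)" for p b x D
  proof -
    interpret D: bounded_linear D using D by (rule has_derivative_bounded_linear)
    have "((\<lambda>t. f (p + t *\<^sub>R b) x) has_derivative (\<lambda>t. D (t *\<^sub>R b))) (at 0)"
      by (rule has_derivative_compose[of "\<lambda>t. p + t *\<^sub>R b" "\<lambda>t. t *\<^sub>R b" 0 UNIV "\<lambda>q. f q x" D])
         (auto intro!: derivative_eq_intros D)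
    then have *: "((\<lambda>t. norm (f (p + t *\<^sub>R b) x - f p x - t *\<^sub>R D b) / norm t) \<longlongrightarrow> 0) (at 0)"
      by (simp add: has_derivative_at D.scaleR)
    have eq: "norm (f (p + t *\<^sub>R b) x - f p x - t *\<^sub>R D b) / norm t
        = norm ((f (p + t *\<^sub>R b) x - f p x) /\<^sub>R t - D b)" if "t \<noteq> 0" for t
    proof -
      have "(f (p + t *\<^sub>R b) x - f p x) /\<^sub>R t - D b = (f (p + t *\<^sub>R b) x - f p x - t *\<^sub>R D b) /\<^sub>R t"
        using that by (simp add: scaleR_diff_right)
      then show ?thesis by (simp add: divide_inverse mult.commute)
    qed
    have lim0: "((\<lambda>t. (f (p + t *\<^sub>R b) x - f p x) /\<^sub>R t) \<longlongrightarrow> D b) (at 0)"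
      unfolding LIM_zero_iff[symmetric, of _ "D b"] tendsto_norm_zero_iff[symmetric, of "\<lambda>t. _ t - D b"]
      by (rule Lim_transform_eventually[OF *]) (simp add: eventually_at_filter eq del: real_norm_def)
    have seq: "filterlim (\<lambda>k. 1 / real (Suc k)) (at 0) sequentially"
      using LIMSEQ_Suc[OF lim_1_over_n] by (simp add: filterlim_at del: of_nat_Suc)
    have "(\<lambda>k. (f (p + (1 / real (Suc k)) *\<^sub>R b) x - f p x) /\<^sub>R (1 / real (Suc k))) \<longlonglongrightarrow> D b"
      by (rule filterlim_compose[OF lim0 seq])
    moreover have "eventually (\<lambda>k. (f (p + (1 / real (Suc k)) *\<^sub>R b) x - f p x) /\<^sub>R (1 / real (Suc k))
        = real (Suc k) *\<^sub>R (F (p + (1 / real (Suc k)) *\<^sub>R b) x - F p x)) sequentially"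
    proof -
      have "(\<lambda>k. p + (1 / real (Suc k)) *\<^sub>R b) \<longlonglongrightarrow> p + 0 *\<^sub>R b"
        by (intro tendsto_intros LIMSEQ_Suc lim_1_over_n)
      then have "eventually (\<lambda>k. p + (1 / real (Suc k)) *\<^sub>R b \<in> S) sequentially"
        using topological_tendstoD[OF _ S] p by fastforce
      then show ?thesis by eventually_elim (use p in \<open>simp add: F_def\<close>)
    qed
    ultimately have "(\<lambda>k. real (Suc k) *\<^sub>R (F (p + (1 / real (Suc k)) *\<^sub>R b) x - F p x)) \<longlonglongrightarrow> D b"
      by (rule Lim_transform_eventually)
    then show ?thesis unfolding q_def by (rule limI)
  qed
  show ?thesis
  proof
    show "g p d \<in> borel_measurable M" for p d
      unfolding g_def[abs_def] using q by measurable
    show "linear (\<lambda>d. g p d x)" for p x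
      by (rule linearI) (auto simp: g_def inner_add_left scaleR_add_left sum.distrib scaleR_sum_right)
    fix x p D assume p: "p \<in> S" and D: "((\<lambda>q. f q x) has_derivative D) (at p)"
    interpret D: bounded_linear D using D by (rule has_derivative_bounded_linear)
    show "(\<lambda>d. g p d x) = D"
    proof
      fix d
      have "D d = D (\<Sum>b\<in>Basis. (d \<bullet> b) *\<^sub>R b)" by (simp add: euclidean_representation)
      also have "\<dots> = g p d x" unfolding g_def qD[OF p D] by (simp add: D.sum D.scaleR)
      finally show "g p d x = D d" by simp
    qed
  qed
qed

text \<open>The supremum over a countable dense subset of \<open>B\<close> is measurable for all \<open>x\<close>. At the points of \<open>C\<close> continuity
makes it the supremum over \<open>B\<close>, and compactness of \<open>K\<close> makes it finite, so that a real-valued \<open>W\<close> can represent it.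
Elsewhere \<open>W\<close> is an arbitrary real number, 0 where the supremum is infinite.\<close>

lemma measurable_sup:
  fixes f :: "'p::euclidean_space \<Rightarrow> 'x \<Rightarrow> real"
  assumes K: "compact K" "B \<subseteq> K"
    and meas: "\<And>p. p \<in> B \<Longrightarrow> f p \<in> borel_measurable M"
    and cont: "\<And>x. x \<in> C \<Longrightarrow> continuous_on K (\<lambda>p. f p x)"
  obtains W where "W \<in> borel_measurable M" "\<And>x. 0 \<le> W x"
    "\<And>x. x \<in> C \<Longrightarrow> ennreal (W x) = (SUP p\<in>B. ennreal (f p x))"
proof -
  obtain D where D: "countable D" "D \<subseteq> B" "B \<subseteq> closure D"
    using separable[of B] by blast
  define W where "W x = enn2real (SUP p\<in>D. ennreal (f p x))" for x
  have eq: "(SUP p\<in>D. ennreal (f p x)) = (SUP p\<in>B. ennreal (f p x))" if "x \<in> C" for x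
  proof (rule antisym)
    show "(SUP p\<in>D. ennreal (f p x)) \<le> (SUP p\<in>B. ennreal (f p x))"
      by (rule SUP_subset_mono) (use D in auto)
    show "(SUP p\<in>B. ennreal (f p x)) \<le> (SUP p\<in>D. ennreal (f p x))"
    proof (rule SUP_least)
      fix p assume p: "p \<in> B"
      obtain z where z: "\<And>k. z k \<in> D" "z \<longlonglongrightarrow> p"
        using subsetD[OF D(3) p] unfolding closure_sequential by blast
      have "(\<lambda>k. f (z k) x) \<longlonglongrightarrow> f p x"
        by (rule continuous_on_tendsto_compose[OF cont[OF that] z(2)]) (use p K(2) D(2) z(1) in \<open>auto intro!: always_eventually\<close>)
      then have "(\<lambda>k. ennreal (f (z k) x)) \<longlonglongrightarrow> ennreal (f p x)" by (rule tendsto_ennrealI)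
      then show "ennreal (f p x) \<le> (SUP p\<in>D. ennreal (f p x))"
        by (rule LIMSEQ_le_const2) (intro exI allI impI SUP_upper z)
    qed
  qed
  have fin: "(SUP p\<in>B. ennreal (f p x)) < \<top>" if "x \<in> C" for x
  proof -
    have "bounded ((\<lambda>p. f p x) ` K)"
      using compact_continuous_image[OF cont[OF that] K(1)] by (rule compact_imp_bounded)
    then obtain b where "\<forall>p\<in>K. norm (f p x) \<le> b" by (auto simp: bounded_iff)
    then have "(SUP p\<in>B. ennreal (f p x)) \<le> ennreal b"
      using K(2) by (intro SUP_least ennreal_leI) (auto simp: abs_le_iff)
    then show ?thesis using ennreal_less_top le_less_trans by blast
  qed
  show ?thesis
  proof
    show "W \<in> borel_measurable M"
      unfolding W_def[abs_def]
      by (rule measurable_compose[OF borel_measurable_SUP[OF D(1)] borel_measurable_enn2real])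
         (use D(2) in \<open>auto intro!: measurable_compose[OF meas measurable_ennreal]\<close>)
    show "0 \<le> W x" for x by (simp add: W_def)
    show "ennreal (W x) = (SUP p\<in>B. ennreal (f p x))" if "x \<in> C" for x
      unfolding W_def eq[OF that] using fin[OF that] by simp
  qed
qed

lemma ennreal_le_SUP_iff:
  assumes "ennreal w = (SUP p\<in>B. ennreal (f p))" "0 \<le> w"
  shows "p \<in> B \<Longrightarrow> f p \<le> w" and "0 \<le> c \<Longrightarrow> (\<And>p. p \<in> B \<Longrightarrow> f p \<le> c) \<Longrightarrow> w \<le> c"
proof -
  show "f p \<le> w" if "p \<in> B"
  proof -
    have "ennreal (f p) \<le> ennreal w" unfolding assms(1) by (rule SUP_upper[OF that])
    then show ?thesis using assms(2) by simp
  qed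
  show "w \<le> c" if "0 \<le> c" "\<And>p. p \<in> B \<Longrightarrow> f p \<le> c"
  proof -
    have "ennreal w \<le> ennreal c" unfolding assms(1) by (intro SUP_least ennreal_leI that(2))
    then show ?thesis using that(1) by simp
  qed
qed

text \<open>The given bound \<open>w\<close> need not be measurable, so its integral is only a lower integral. The supremum of the family
is measurable, lies below \<open>w\<close>, and is therefore an integrable substitute.\<close>

lemma integrable_envelope:
  fixes f :: "'p::euclidean_space \<Rightarrow> 'x \<Rightarrow> 'e::euclidean_space"
  assumes K: "compact K" "B \<subseteq> K"
    and meas: "\<And>p. p \<in> B \<Longrightarrow> f p \<in> borel_measurable P"
    and C: "AE x in P. x \<in> C"
    and cont: "\<And>x. x \<in> C \<Longrightarrow> continuous_on K (\<lambda>p. f p x)"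
    and bound: "\<And>x p. x \<in> C \<Longrightarrow> p \<in> B \<Longrightarrow> ennreal (norm (f p x)) \<le> w x"
    and int: "(\<integral>\<^sup>+x. w x \<partial>P) < \<infinity>"
  obtains W where "integrable P W" "\<And>x. 0 \<le> W x" "\<And>x p. x \<in> C \<Longrightarrow> p \<in> B \<Longrightarrow> norm (f p x) \<le> W x"
proof -
  obtain W where W: "W \<in> borel_measurable P" "\<And>x. 0 \<le> W x"
      "\<And>x. x \<in> C \<Longrightarrow> ennreal (W x) = (SUP p\<in>B. ennreal (norm (f p x)))"
    using measurable_sup[OF K measurable_compose[OF meas borel_measurable_norm] continuous_on_norm[OF cont]] by blast
  have "(\<integral>\<^sup>+x. ennreal (norm (W x)) \<partial>P) \<le> (\<integral>\<^sup>+x. w x \<partial>P)"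
    using C by (intro nn_integral_mono_AE, eventually_elim) (auto simp: W(2,3) intro!: SUP_least bound)
  then have iW: "integrable P W" using int W(1) by (intro integrableI_bounded) auto
  have upper: "norm (f p x) \<le> W x" if "x \<in> C" "p \<in> B" for x p
    using ennreal_le_SUP_iff(1)[OF W(3)[OF that(1)] W(2) that(2)] .
  show ?thesis by (rule that[OF iW W(2) upper])
qed

text \<open>Leibniz rule by dominated convergence. It suffices to consider sequences of parameters; by the mean value
inequality the remainder divided by the norm of the increment is at most \<open>2 * W x\<close>.\<close>

lemma has_derivative_integral:
  fixes f :: "'p::euclidean_space \<Rightarrow> 'x \<Rightarrow> 'e::euclidean_space"
  assumes S: "open S" "convex S" "p \<in> S"
    and int: "\<And>q. q \<in> S \<Longrightarrow> integrable P (f q)"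
    and D: "\<And>d. D p d \<in> borel_measurable P" "\<And>x. linear (\<lambda>d. D p d x)"
    and C: "AE x in P. x \<in> C"
    and deriv: "\<And>q x. x \<in> C \<Longrightarrow> q \<in> S \<Longrightarrow> ((\<lambda>q. f q x) has_derivative (\<lambda>d. D q d x)) (at q)"
    and W: "integrable P W" "\<And>q x d. x \<in> C \<Longrightarrow> q \<in> S \<Longrightarrow> norm (D q d x) \<le> W x * norm d"
  shows "((\<lambda>q. \<integral>x. f q x \<partial>P) has_derivative (\<lambda>d. \<integral>x. D p d x \<partial>P)) (at p)"
proof -
  have intD: "integrable P (D p d)" for d
  proof (rule Bochner_Integration.integrable_bound)
    show "integrable P (\<lambda>x. W x * norm d)" using W(1) by simp
    show "AE x in P. norm (D p d x) \<le> norm (W x * norm d)"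
      using C
    proof eventually_elim
      case (elim x)
      show ?case using order_trans[OF W(2)[OF elim S(3)] abs_ge_self] by (simp only: real_norm_def)
    qed
  qed (rule D)
  have lin: "linear (\<lambda>d. \<integral>x. D p d x \<partial>P)"
    by (rule linearI) (simp_all add: linear_add[OF D(2)] linear_cmul[OF D(2)] intD)
  let ?I = "\<lambda>q. \<integral>x. f q x \<partial>P" and ?D = "\<lambda>d. \<integral>x. D p d x \<partial>P"
  have lim: "((\<lambda>q. (f q x - f p x - D p (q - p) x) /\<^sub>R norm (q - p)) \<longlongrightarrow> 0) (at p)" if "x \<in> C" for x
    using deriv[OF that S(3)] by (simp add: has_derivative_at_within)
  have "((\<lambda>q. (?I q - ?I p - ?D (q - p)) /\<^sub>R norm (q - p)) \<longlongrightarrow> 0) (at p)"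
    unfolding tendsto_at_iff_sequentially comp_def
  proof (intro allI impI)
    fix z :: "nat \<Rightarrow> 'p" assume z: "\<forall>i. z i \<in> UNIV - {p}" "z \<longlonglongrightarrow> p"
    let ?g = "\<lambda>k x. (f (z k) x - f p x - D p (z k - p) x) /\<^sub>R norm (z k - p)"
    obtain N where N: "\<And>k. k \<ge> N \<Longrightarrow> z k \<in> S"
      using topological_tendstoD[OF z(2) S(1,3)] by (auto simp: eventually_sequentially)
    have "(\<lambda>k. \<integral>x. ?g (k + N) x \<partial>P) \<longlonglongrightarrow> (\<integral>x. (0::'e) \<partial>P)"
    proof (rule integral_dominated_convergence)
      show "integrable P (\<lambda>x. 2 * W x)" using W(1) by simp
      show "?g (k + N) \<in> borel_measurable P" for k
        using int[THEN borel_measurable_integrable] N S(3) D(1)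
        by (intro borel_measurable_scaleR borel_measurable_diff borel_measurable_const) auto
      show "AE x in P. (\<lambda>k. ?g (k + N) x) \<longlonglongrightarrow> 0"
        using C
      proof eventually_elim
        fix x assume x: "x \<in> C"
        have "(\<lambda>k. ?g k x) \<longlonglongrightarrow> 0"
          using lim[OF x] z unfolding tendsto_at_iff_sequentially comp_def by blast
        then show "(\<lambda>k. ?g (k + N) x) \<longlonglongrightarrow> 0" by (rule LIMSEQ_ignore_initial_segment)
      qed
      show "AE x in P. norm (?g (k + N) x) \<le> 2 * W x" for k
        using C
      proof eventually_elim
        fix x assume x: "x \<in> C"
        let ?z = "z (k + N)"
        have zS: "?z \<in> S" using N by simp
        have "norm (f ?z x - f p x) \<le> W x * norm (?z - p)"
        proof (rule differentiable_bound[OF S(2) _ _ zS S(3)])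
          fix q assume q: "q \<in> S"
          show "((\<lambda>q. f q x) has_derivative (\<lambda>d. D q d x)) (at q within S)"
            using deriv[OF x q] has_derivative_at_withinI by blast
          show "onorm (\<lambda>d. D q d x) \<le> W x"
            by (rule onorm_le) (rule W(2)[OF x q])
        qed
        moreover have "norm (D p (?z - p) x) \<le> W x * norm (?z - p)" by (rule W(2)[OF x S(3)])
        ultimately have "norm (f ?z x - f p x - D p (?z - p) x) \<le> 2 * W x * norm (?z - p)"
          using norm_triangle_ineq4[of "f ?z x - f p x" "D p (?z - p) x"] by linarith
        then show "norm (?g (k + N) x) \<le> 2 * W x"
          using z(1) by (simp add: divide_inverse_commute[symmetric] pos_divide_le_eq)
      qed
    qed simp
    also have "(\<lambda>k. \<integral>x. ?g (k + N) x \<partial>P) = (\<lambda>k. (?I (z (k + N)) - ?I p - ?D (z (k + N) - p)) /\<^sub>R norm (z (k + N) - p))"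
      using int N S(3) intD by (intro ext) simp
    finally show "(\<lambda>k. (?I (z k) - ?I p - ?D (z k - p)) /\<^sub>R norm (z k - p)) \<longlonglongrightarrow> 0"
      by (simp add: LIMSEQ_offset)
  qed
  then show ?thesis using lin by (simp add: has_derivative_at_within linear_conv_bounded_linear)
qed

lemma integrable_of_bound:
  fixes f :: "'x \<Rightarrow> 'e::euclidean_space"
  assumes "f \<in> borel_measurable P" "AE x in P. x \<in> C"
    and "\<And>x. x \<in> C \<Longrightarrow> ennreal (norm (f x)) \<le> w x" "(\<integral>\<^sup>+x. w x \<partial>P) < \<infinity>"
  shows "integrable P f"
proof (rule integrableI_bounded[OF assms(1)])
  have "(\<integral>\<^sup>+x. ennreal (norm (f x)) \<partial>P) \<le> (\<integral>\<^sup>+x. w x \<partial>P)"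
    by (rule nn_integral_mono_AE) (use assms(2,3) in \<open>auto elim: eventually_mono\<close>)
  then show "(\<integral>\<^sup>+x. ennreal (norm (f x)) \<partial>P) < \<infinity>" using assms(4) by (rule le_less_trans)
qed

text \<open>The Leibniz rule with a dominating function \<open>w\<close> that need not be measurable. Halving the radius provides the compact
ball on which \<open>integrable_envelope\<close> applies to the finitely many partial derivatives.\<close>

lemma has_derivative_integral_ball:
  fixes f :: "'p::euclidean_space \<Rightarrow> 'x \<Rightarrow> 'e::euclidean_space"
  assumes p: "p \<in> ball c (\<delta> / 2)"
    and f: "\<And>q. q \<in> ball c \<delta> \<Longrightarrow> f q \<in> borel_measurable P"
    and D: "\<And>q d. q \<in> ball c \<delta> \<Longrightarrow> D q d \<in> borel_measurable P" "\<And>q x. linear (\<lambda>d. D q d x)"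
    and C: "AE x in P. x \<in> C"
    and deriv: "\<And>q x. x \<in> C \<Longrightarrow> q \<in> ball c \<delta> \<Longrightarrow> ((\<lambda>q. f q x) has_derivative (\<lambda>d. D q d x)) (at q)"
    and cont: "\<And>x d. x \<in> C \<Longrightarrow> continuous_on (ball c \<delta>) (\<lambda>q. D q d x)"
    and bound: "\<And>q x. x \<in> C \<Longrightarrow> q \<in> ball c \<delta> \<Longrightarrow> ennreal (norm (f q x)) \<le> w x"
      "\<And>q x b. x \<in> C \<Longrightarrow> q \<in> ball c \<delta> \<Longrightarrow> b \<in> Basis \<Longrightarrow> ennreal (norm (D q b x)) \<le> w x"
    and int: "(\<integral>\<^sup>+x. w x \<partial>P) < \<infinity>"
  shows "((\<lambda>q. \<integral>x. f q x \<partial>P) has_derivative (\<lambda>d. \<integral>x. D p d x \<partial>P)) (at p)"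
proof -
  have sub: "ball c (\<delta> / 2) \<subseteq> cball c (\<delta> / 2)" "cball c (\<delta> / 2) \<subseteq> ball c \<delta>" "ball c (\<delta> / 2) \<subseteq> ball c \<delta>"
    using le_less_trans[OF zero_le_dist p[unfolded mem_ball]] by (auto simp: mem_ball mem_cball)
  have "\<exists>W. integrable P W \<and> (\<forall>x\<in>C. \<forall>q\<in>ball c (\<delta> / 2). norm (D q b x) \<le> W x)" if b: "b \<in> Basis" for b
  proof -
    obtain W where "integrable P W" "\<And>x. 0 \<le> W x"
        "\<And>x q. x \<in> C \<Longrightarrow> q \<in> ball c (\<delta> / 2) \<Longrightarrow> norm (D q b x) \<le> W x"
      by (rule integrable_envelope[OF compact_cball sub(1) D(1)[OF subsetD[OF sub(3)]] C
          continuous_on_subset[OF cont sub(2)] bound(2)[OF _ subsetD[OF sub(3)] b] int]) auto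
    then show ?thesis by blast
  qed
  then obtain W where W: "\<And>b. b \<in> Basis \<Longrightarrow> integrable P (W b)"
      "\<And>b x q. b \<in> Basis \<Longrightarrow> x \<in> C \<Longrightarrow> q \<in> ball c (\<delta> / 2) \<Longrightarrow> norm (D q b x) \<le> W b x"
    by metis
  show ?thesis
  proof (rule has_derivative_integral[where D = D, OF open_ball convex_ball p _ D(1)[OF subsetD[OF sub(3) p]] D(2) C])
    show "integrable P (f q)" if "q \<in> ball c (\<delta> / 2)" for q
      by (rule integrable_of_bound[OF f C bound(1) int]) (use that sub in auto)
    show "((\<lambda>q. f q x) has_derivative (\<lambda>d. D q d x)) (at q)" if "x \<in> C" "q \<in> ball c (\<delta> / 2)" for q x
      using deriv that sub by blast
    show "integrable P (\<lambda>x. \<Sum>b\<in>Basis. W b x)" by (simp add: W(1))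
    fix q x d assume x: "x \<in> C" and q: "q \<in> ball c (\<delta> / 2)"
    have lin: "linear (\<lambda>d. D q d x)" by (rule D(2))
    have "D q d x = (\<Sum>b\<in>Basis. (d \<bullet> b) *\<^sub>R D q b x)"
      using linear_sum[OF lin, of "\<lambda>b. (d \<bullet> b) *\<^sub>R b" Basis]
      by (simp add: linear_cmul[OF lin] euclidean_representation)
    also have "norm \<dots> \<le> (\<Sum>b\<in>Basis. W b x * norm d)"
    proof (rule sum_norm_le)
      fix b :: 'p assume b: "b \<in> Basis"
      have "norm d * norm (D q b x) \<le> norm d * W b x" by (rule mult_left_mono[OF W(2)[OF b x q]]) simp
      moreover have "\<bar>d \<bullet> b\<bar> * norm (D q b x) \<le> norm d * norm (D q b x)"
        by (rule mult_right_mono[OF Basis_le_norm[OF b]]) simp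
      ultimately show "norm ((d \<bullet> b) *\<^sub>R D q b x) \<le> W b x * norm d" by (simp add: mult.commute)
    qed
    finally show "norm (D q d x) \<le> (\<Sum>b\<in>Basis. W b x) * norm d" by (simp add: sum_distrib_right)
  qed
qed

section \<open>Uniform convergence of ergodic averages\<close>

text \<open>A uniform law of large numbers, stated as joint convergence in \<open>m\<close> and \<open>p\<close>. Let \<open>V k\<close> be the oscillation of \<open>f\<close> over a
ball around \<open>p0\<close> whose radius shrinks with \<open>k\<close>. Its integral tends to 0 by dominated convergence, and ergodicity
transfers this to the averages of \<open>V k\<close>, which bound the distance from the averages of \<open>f p\<close> to those of \<open>f p0\<close>. Only countably many
functions are involved, so one almost sure event serves for all parameters.\<close>

lemma uniform_ergodic_average:
  fixes f :: "'p::euclidean_space \<Rightarrow> 'x \<Rightarrow> 'e::euclidean_space"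
  assumes erg: "ergodic_process M P X"
    and S: "open S" "p0 \<in> S"
    and meas: "\<And>p. p \<in> S \<Longrightarrow> f p \<in> borel_measurable P"
    and C: "AE x in P. x \<in> C" "AE \<omega> in M. \<forall>j\<ge>1. X j \<omega> \<in> C"
    and cont: "\<And>x. x \<in> C \<Longrightarrow> continuous_on S (\<lambda>p. f p x)"
    and bound: "\<And>x p. x \<in> C \<Longrightarrow> p \<in> S \<Longrightarrow> ennreal (norm (f p x)) \<le> w x"
    and int: "(\<integral>\<^sup>+x. w x \<partial>P) < \<infinity>"
  shows "AE \<omega> in M. ((\<lambda>(m, p). (\<Sum>j=1..m. f p (X j \<omega>)) /\<^sub>R real m) \<longlongrightarrow> (\<integral>x. f p0 x \<partial>P))
    (sequentially \<times>\<^sub>F nhds p0)"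
proof -
  obtain \<delta> where \<delta>: "0 < \<delta>" "cball p0 \<delta> \<subseteq> S"
    using S open_contains_cball by blast
  define B where "B k = ball p0 (\<delta> / real (Suc k))" for k
  have B: "B k \<subseteq> cball p0 \<delta>" "B k \<subseteq> S" "p0 \<in> B k" "open (B k)" for k
  proof -
    have "\<delta> / real (Suc k) \<le> \<delta>" using \<delta>(1) by (simp add: field_simps)
    then show "B k \<subseteq> cball p0 \<delta>" unfolding B_def by auto
    then show "B k \<subseteq> S" using \<delta>(2) by blast
  qed (use \<delta>(1) in \<open>auto simp: B_def\<close>)
  have contK: "continuous_on (cball p0 \<delta>) (\<lambda>p. f p x)" if "x \<in> C" for x
    using continuous_on_subset[OF cont[OF that] \<delta>(2)] .
  obtain E where E: "integrable P E" "\<And>x. 0 \<le> E x" "\<And>x p. x \<in> C \<Longrightarrow> p \<in> cball p0 \<delta> \<Longrightarrow> norm (f p x) \<le> E x"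
    by (rule integrable_envelope[OF compact_cball order_refl meas[OF subsetD[OF \<delta>(2)]] C(1) contK
        bound[OF _ subsetD[OF \<delta>(2)]] int]) auto
  have "\<exists>V. V \<in> borel_measurable P \<and> (\<forall>x. 0 \<le> V x) \<and> (\<forall>x\<in>C. ennreal (V x) = (SUP p\<in>B k. ennreal (norm (f p x - f p0 x))))" for k
  proof -
    have m: "(\<lambda>x. norm (f p x - f p0 x)) \<in> borel_measurable P" if "p \<in> B k" for p
      by (intro measurable_compose[OF _ borel_measurable_norm] borel_measurable_diff meas S(2) subsetD[OF B(2) that])
    have c: "continuous_on (cball p0 \<delta>) (\<lambda>p. norm (f p x - f p0 x))" if "x \<in> C" for x
      by (intro continuous_intros contK that)
    obtain V where "V \<in> borel_measurable P" "\<And>x. 0 \<le> V x"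
        "\<And>x. x \<in> C \<Longrightarrow> ennreal (V x) = (SUP p\<in>B k. ennreal (norm (f p x - f p0 x)))"
      by (rule measurable_sup[OF compact_cball B(1) m c]) auto
    then show ?thesis by blast
  qed
  then obtain V where V: "\<And>k. V k \<in> borel_measurable P" "\<And>k x. 0 \<le> V k x"
      "\<And>k x. x \<in> C \<Longrightarrow> ennreal (V k x) = (SUP p\<in>B k. ennreal (norm (f p x - f p0 x)))"
    by metis
  have V_upper: "norm (f p x - f p0 x) \<le> V k x" if "x \<in> C" "p \<in> B k" for x p k
    using ennreal_le_SUP_iff(1)[OF V(3)[OF that(1)] V(2) that(2)] .
  have V_least: "V k x \<le> c" if "x \<in> C" "0 \<le> c" "\<And>p. p \<in> B k \<Longrightarrow> norm (f p x - f p0 x) \<le> c" for x k c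
    using ennreal_le_SUP_iff(2)[OF V(3)[OF that(1)] V(2) that(2,3)] .
  have V_le: "V k x \<le> 2 * E x" if x: "x \<in> C" for x k
  proof (rule V_least[OF x])
    fix p assume "p \<in> B k"
    then have "norm (f p x) \<le> E x" "norm (f p0 x) \<le> E x"
      using E(3)[OF x] B(1,3) by blast+
    then show "norm (f p x - f p0 x) \<le> 2 * E x"
      using norm_triangle_ineq4[of "f p x" "f p0 x"] by linarith
  qed (simp add: E(2))
  have V_lim: "(\<lambda>k. V k x) \<longlonglongrightarrow> 0" if x: "x \<in> C" for x
  proof (rule LIMSEQ_I)
    fix e :: real assume e: "0 < e"
    have "isCont (\<lambda>p. f p x) p0"
      using cont[OF x] S continuous_on_eq_continuous_at by blast
    then obtain d where d: "0 < d" "\<And>p. dist p p0 < d \<Longrightarrow> dist (f p x) (f p0 x) < e / 2"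
      unfolding continuous_at_eps_delta using e by (metis half_gt_zero)
    have dk: "(\<lambda>k. \<delta> / real (Suc k)) \<longlonglongrightarrow> 0"
      by (rule LIMSEQ_Suc[OF lim_const_over_n])
    obtain N where N: "\<And>k. k \<ge> N \<Longrightarrow> \<delta> / real (Suc k) < d"
      using order_tendstoD(2)[OF dk d(1)] unfolding eventually_sequentially by blast
    have "V k x \<le> e / 2" if "k \<ge> N" for k
    proof (rule V_least[OF x])
      fix p assume "p \<in> B k"
      then have "dist p p0 < d" using N[OF that] by (simp add: B_def dist_commute)
      then show "norm (f p x - f p0 x) \<le> e / 2" using d(2) by (force simp: dist_norm)
    qed (use e in simp)
    then show "\<exists>N. \<forall>k\<ge>N. norm (V k x - 0) < e" using V(2) e by (intro exI[of _ N]) fastforce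
  qed
  have intV: "integrable P (V k)" for k
    by (rule Bochner_Integration.integrable_bound[of P "\<lambda>x. 2 * E x"])
       (use C(1) E(1) V(1) in \<open>auto elim!: eventually_mono simp: V(2) E(2) V_le\<close>)
  have int0: "integrable P (f p0)"
    by (rule Bochner_Integration.integrable_bound[OF E(1) meas[OF S(2)]])
       (use C(1) in \<open>eventually_elim, use E(2,3) \<delta>(1) in auto\<close>)
  have "(\<lambda>k. \<integral>x. V k x \<partial>P) \<longlonglongrightarrow> (\<integral>x. 0 \<partial>P)"
    by (rule integral_dominated_convergence[where w = "\<lambda>x. 2 * E x"])
       (use C(1) E(1) V(1) in \<open>auto elim!: eventually_mono simp: V(2) V_le V_lim\<close>)
  then have intV_lim: "(\<lambda>k. \<integral>x. V k x \<partial>P) \<longlonglongrightarrow> 0" by simp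
  have "AE \<omega> in M. \<forall>k. (\<lambda>m. (\<Sum>j=1..m. V k (X j \<omega>)) / real m) \<longlonglongrightarrow> (\<integral>x. V k x \<partial>P)"
    unfolding AE_all_countable using erg intV unfolding ergodic_process_def by blast
  moreover have "AE \<omega> in M. \<forall>b\<in>Basis. (\<lambda>m. (\<Sum>j=1..m. f p0 (X j \<omega>) \<bullet> b) / real m) \<longlonglongrightarrow> (\<integral>x. f p0 x \<bullet> b \<partial>P)"
  proof (rule AE_finite_allI)
    fix b :: 'e
    have "integrable P (\<lambda>x. f p0 x \<bullet> b)" using int0 by simp
    then show "AE \<omega> in M. (\<lambda>m. (\<Sum>j=1..m. f p0 (X j \<omega>) \<bullet> b) / real m) \<longlonglongrightarrow> (\<integral>x. f p0 x \<bullet> b \<partial>P)"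
      using erg unfolding ergodic_process_def by blast
  qed simp
  ultimately show ?thesis using C(2)
  proof eventually_elim
    case (elim \<omega>)
    let ?A = "\<lambda>p m. (\<Sum>j=1..m. f p (X j \<omega>)) /\<^sub>R real m" and ?L = "\<integral>x. f p0 x \<partial>P"
    have lim0: "?A p0 \<longlonglongrightarrow> ?L"
      unfolding tendsto_componentwise_iff[of "?A p0"]
      using elim(2) int0 by (auto simp: inner_sum_left divide_inverse mult.commute)
    show ?case
    proof (rule tendstoI)
      fix e :: real assume e: "0 < e"
      obtain k where k: "(\<integral>x. V k x \<partial>P) < e / 2"
        using order_tendstoD(2)[OF intV_lim, of "e / 2"] e by (auto simp: eventually_sequentially)
      have "eventually (\<lambda>m. (\<Sum>j=1..m. V k (X j \<omega>)) / real m < e / 2) sequentially"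
        using elim(1) order_tendstoD(2)[OF _ k] by blast
      moreover have "eventually (\<lambda>m. dist (?A p0 m) ?L < e / 2) sequentially"
        using tendstoD[OF lim0, of "e / 2"] e by simp
      ultimately have m: "eventually (\<lambda>m. (\<Sum>j=1..m. V k (X j \<omega>)) / real m < e / 2 \<and> dist (?A p0 m) ?L < e / 2) sequentially"
        by (rule eventually_conj)
      have p: "eventually (\<lambda>p. p \<in> B k) (nhds p0)"
        using B(3,4) eventually_nhds by blast
      show "eventually (\<lambda>mp. dist (case mp of (m, p) \<Rightarrow> ?A p m) ?L < e) (sequentially \<times>\<^sub>F nhds p0)"
        using eventually_prodI[OF m p]
      proof (rule eventually_mono)
        fix mp :: "nat \<times> 'p"
        obtain m p where mp: "mp = (m, p)" by (cases mp)
        assume "((\<Sum>j=1..fst mp. V k (X j \<omega>)) / real (fst mp) < e / 2 \<and> dist (?A p0 (fst mp)) ?L < e / 2) \<and> snd mp \<in> B k"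
        then have *: "(\<Sum>j=1..m. V k (X j \<omega>)) / real m < e / 2" "dist (?A p0 m) ?L < e / 2" "p \<in> B k"
          by (auto simp: mp)
        have "norm (\<Sum>j=1..m. f p (X j \<omega>) - f p0 (X j \<omega>)) \<le> (\<Sum>j=1..m. V k (X j \<omega>))"
          by (rule sum_norm_le) (use V_upper elim(3) *(3) in auto)
        then have "norm (?A p m - ?A p0 m) \<le> (\<Sum>j=1..m. V k (X j \<omega>)) / real m"
          by (simp add: sum_subtractf divide_inverse_commute mult_left_mono flip: scaleR_diff_right)
        from le_less_trans[OF this *(1)] have "dist (?A p m) (?A p0 m) < e / 2"
          by (simp only: dist_norm)
        then show "dist (case mp of (m, p) \<Rightarrow> ?A p m) ?L < e"
          using *(2) dist_triangle_half_r[of "?A p0 m" "?A p m" e ?L] unfolding mp by (simp add: dist_commute)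
      qed
    qed
  qed
qed

text \<open>Separates the measurable version \<open>f\<close>, to which ergodicity applies, from the function \<open>F\<close> of interest. The two have
equal averages because the artificial points stay in \<open>C\<close>.\<close>

lemma uniform_ergodic_average_version:
  fixes f F :: "'p::euclidean_space \<Rightarrow> 'x \<Rightarrow> 'e::euclidean_space"
  assumes erg: "ergodic_process M P X"
    and S: "open S" "p0 \<in> S"
    and meas: "\<And>p. p \<in> S \<Longrightarrow> f p \<in> borel_measurable P"
    and C: "AE x in P. x \<in> C" "AE \<omega> in M. \<forall>j\<ge>1. X j \<omega> \<in> C"
    and F: "\<And>x p. x \<in> C \<Longrightarrow> p \<in> S \<Longrightarrow> f p x = F p x"
    and cont: "\<And>x. x \<in> C \<Longrightarrow> continuous_on S (\<lambda>p. F p x)"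
    and bound: "\<And>x p. x \<in> C \<Longrightarrow> p \<in> S \<Longrightarrow> ennreal (norm (F p x)) \<le> w x"
    and int: "(\<integral>\<^sup>+x. w x \<partial>P) < \<infinity>"
  shows "AE \<omega> in M. ((\<lambda>(m, p). (\<Sum>j=1..m. F p (X j \<omega>)) /\<^sub>R real m) \<longlongrightarrow> (\<integral>x. f p0 x \<partial>P))
    (sequentially \<times>\<^sub>F nhds p0)"
proof -
  have "AE \<omega> in M. ((\<lambda>(m, p). (\<Sum>j=1..m. f p (X j \<omega>)) /\<^sub>R real m) \<longlongrightarrow> (\<integral>x. f p0 x \<partial>P))
    (sequentially \<times>\<^sub>F nhds p0)"
    by (rule uniform_ergodic_average[OF erg S meas C _ _ int])
       (simp_all add: F bound cont cong: continuous_on_cong)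
  then show ?thesis using C(2)
  proof eventually_elim
    case (elim \<omega>)
    have "eventually (\<lambda>p. p \<in> S) (nhds p0)" using S eventually_nhds by blast
    then have "eventually (\<lambda>mp. True \<and> snd mp \<in> S) (sequentially \<times>\<^sub>F nhds p0)"
      by (intro eventually_prodI) simp_all
    then have "eventually (\<lambda>mp. (case mp of (m, p) \<Rightarrow> (\<Sum>j=1..m. f p (X j \<omega>)) /\<^sub>R real m)
        = (case mp of (m, p) \<Rightarrow> (\<Sum>j=1..m. F p (X j \<omega>)) /\<^sub>R real m)) (sequentially \<times>\<^sub>F nhds p0)"
      by eventually_elim (use elim(2) F in \<open>auto simp: case_prod_beta intro!: sum.cong arg_cong2[where f = scaleR]\<close>)
    with elim(1) show ?case by (rule Lim_transform_eventually)
  qed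
qed

section \<open>Approximate zeros of nearby score functions\<close>

text \<open>On a small ball \<open>T m - H\<close> is eventually Lipschitz with a small constant \<open>\<eta>\<close>, so with \<open>z\<^sub>m = m (a\<^sub>m - b\<^sub>m)\<close> the vector \<open>H z\<^sub>m\<close> is within
\<open>\<eta> \<parallel>z\<^sub>m\<parallel>\<close> of a sequence that converges to \<open>q\<close>. Since \<open>H\<close> is bounded below, \<open>z\<^sub>m\<close> is bounded, hence \<open>H z\<^sub>m\<close> converges to \<open>q\<close>.\<close>

lemma tendsto_scaled_difference:
  fixes T :: "nat \<Rightarrow> 'e::euclidean_space \<Rightarrow> 'e"
  assumes W: "open W" "\<xi> \<in> W"
    and deriv: "\<And>m x. 1 \<le> m \<Longrightarrow> x \<in> W \<Longrightarrow> (T m has_derivative DT m x) (at x)"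
    and lim: "\<And>d. ((\<lambda>(m, x). DT m x d) \<longlongrightarrow> H d) (sequentially \<times>\<^sub>F nhds \<xi>)"
    and H: "linear H" "bij H"
    and ab: "a \<longlonglongrightarrow> \<xi>" "b \<longlonglongrightarrow> \<xi>"
    and q: "(\<lambda>m. real m *\<^sub>R (T m (a m) - T m (b m))) \<longlonglongrightarrow> q"
  shows "(\<lambda>m. real m *\<^sub>R (a m - b m)) \<longlonglongrightarrow> inv H q"
proof -
  define z where "z m = real m *\<^sub>R (a m - b m)" for m
  define u where "u m = real m *\<^sub>R (T m (a m) - T m (b m))" for m
  have key: "eventually (\<lambda>m. norm (u m - H (z m)) \<le> \<eta> * norm (z m)) sequentially" if \<eta>: "0 < \<eta>" for \<eta>
  proof -
    have "((\<lambda>mx. \<Sum>d\<in>Basis. norm ((case mx of (m, x) \<Rightarrow> DT m x d) - H d)) \<longlongrightarrow> (\<Sum>d\<in>(Basis::'e set). norm (H d - H d)))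
        (sequentially \<times>\<^sub>F nhds \<xi>)"
      by (intro tendsto_intros lim)
    then have "eventually (\<lambda>mx. (\<Sum>d\<in>Basis. norm ((case mx of (m, x) \<Rightarrow> DT m x d) - H d)) < \<eta>) (sequentially \<times>\<^sub>F nhds \<xi>)"
      using order_tendstoD(2)[of _ 0 _ \<eta>] \<eta> by simp
    then obtain P Q where PQ: "eventually P sequentially" "eventually Q (nhds \<xi>)"
        "\<And>m x. P m \<Longrightarrow> Q x \<Longrightarrow> (\<Sum>d\<in>Basis. norm (DT m x d - H d)) < \<eta>"
      unfolding eventually_prod_filter by auto
    have "eventually (\<lambda>x. Q x \<and> x \<in> W) (nhds \<xi>)"
      using PQ(2) W by (intro eventually_conj) (auto simp: eventually_nhds)
    then obtain \<delta> where \<delta>: "0 < \<delta>" "\<And>x. x \<in> ball \<xi> \<delta> \<Longrightarrow> Q x \<and> x \<in> W"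
      by (auto simp: eventually_nhds_metric dist_commute)
    have "eventually (\<lambda>m. a m \<in> ball \<xi> \<delta>) sequentially" "eventually (\<lambda>m. b m \<in> ball \<xi> \<delta>) sequentially"
      using tendstoD[OF ab(1) \<delta>(1)] tendstoD[OF ab(2) \<delta>(1)] by (simp_all add: dist_commute)
    then show ?thesis using PQ(1) eventually_ge_at_top[of 1]
    proof eventually_elim
      case (elim m)
      have "norm ((T m (a m) - H (a m)) - (T m (b m) - H (b m))) \<le> \<eta> * norm (a m - b m)"
      proof (rule differentiable_bound[OF convex_ball[of \<xi> \<delta>] _ _ elim(1,2)])
        fix x assume x: "x \<in> ball \<xi> \<delta>"
        have D: "(T m has_derivative DT m x) (at x)" using deriv elim(4) \<delta>(2)[OF x] by blast
        show "((\<lambda>x. T m x - H x) has_derivative (\<lambda>d. DT m x d - H d)) (at x within ball \<xi> \<delta>)"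
          using has_derivative_diff[OF D linear_imp_has_derivative[OF H(1)]] has_derivative_at_withinI by blast
        have lin: "linear (\<lambda>d. DT m x d - H d)"
          using has_derivative_linear[OF D] H(1) by (rule linear_compose_sub)
        show "onorm (\<lambda>d. DT m x d - H d) \<le> \<eta>"
        proof (rule onorm_le)
          fix d
          have "DT m x d - H d = (\<Sum>e\<in>Basis. (d \<bullet> e) *\<^sub>R (DT m x e - H e))"
            using linear_sum[OF lin, of "\<lambda>e. (d \<bullet> e) *\<^sub>R e" Basis] linear_cmul[OF lin]
            by (simp add: euclidean_representation)
          also have "norm \<dots> \<le> (\<Sum>e\<in>Basis. norm d * norm (DT m x e - H e))"
            by (rule sum_norm_le) (simp add: Basis_le_norm mult_right_mono)
          also have "\<dots> \<le> \<eta> * norm d"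
            using PQ(3)[OF elim(3)] \<delta>(2)[OF x] by (simp add: mult.commute[of \<eta>] mult_left_mono less_imp_le flip: sum_distrib_left)
          finally show "norm (DT m x d - H d) \<le> \<eta> * norm d" .
        qed
      qed
      then have "real m * norm ((T m (a m) - H (a m)) - (T m (b m) - H (b m))) \<le> real m * (\<eta> * norm (a m - b m))"
        by (rule mult_left_mono) simp
      moreover have "u m - H (z m) = real m *\<^sub>R ((T m (a m) - H (a m)) - (T m (b m) - H (b m)))"
        unfolding u_def z_def by (simp add: linear_cmul[OF H(1)] linear_diff[OF H(1)] algebra_simps)
      ultimately show "norm (u m - H (z m)) \<le> \<eta> * norm (z m)" by (simp add: z_def mult_ac)
    qed
  qed
  \<comment> \<open>The choice \<open>\<eta> = B / 2\<close> below lets the error be absorbed into the lower bound and yields boundedness of \<open>z\<close>.\<close>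
  obtain B where B: "0 < B" "\<And>x. B * norm x \<le> norm (H x)"
    using linear_inj_bounded_below_pos[OF H(1)] bij_is_inj[OF H(2)] by blast
  have u: "u \<longlonglongrightarrow> q" using q by (simp add: u_def[abs_def])
  define c where "c = 2 * (norm q + 1) / B"
  have c: "0 < c" using B(1) by (auto simp: c_def intro!: divide_pos_pos add_nonneg_pos)
  have "eventually (\<lambda>m. norm (u m) < norm q + 1) sequentially"
    using order_tendstoD(2)[OF tendsto_norm[OF u]] by simp
  then have bdd: "eventually (\<lambda>m. norm (z m) \<le> c) sequentially"
    using key[OF half_gt_zero[OF B(1)]]
  proof eventually_elim
    case (elim m)
    have "B * norm (z m) \<le> norm (u m) + B / 2 * norm (z m)"
      using B(2)[of "z m"] elim(2) norm_triangle_sub[of "H (z m)" "u m"] by (simp add: norm_minus_commute)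
    then have "B * norm (z m) \<le> 2 * (norm q + 1)" using elim(1) by simp
    then show ?case using B(1) by (simp add: c_def field_simps)
  qed
  have "(\<lambda>m. u m - H (z m)) \<longlonglongrightarrow> 0"
  proof (rule tendstoI)
    fix e :: real assume e: "0 < e"
    have ec: "0 < e / (2 * c)" using e c by simp
    show "eventually (\<lambda>m. dist (u m - H (z m)) 0 < e) sequentially"
      using bdd key[OF ec]
    proof eventually_elim
      case (elim m)
      have "norm (u m - H (z m)) \<le> e / (2 * c) * norm (z m)" using elim(2) .
      also have "\<dots> \<le> e / (2 * c) * c" by (rule mult_left_mono[OF elim(1)]) (use e c in simp)
      also have "\<dots> < e" using e c by simp
      finally show ?case by simp
    qed
  qed
  then have "(\<lambda>m. u m - (u m - H (z m))) \<longlonglongrightarrow> q - 0" by (intro tendsto_diff u)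
  then have Hz: "(\<lambda>m. H (z m)) \<longlonglongrightarrow> q" by simp
  have "(\<lambda>m. z m - inv H q) \<longlonglongrightarrow> 0"
  proof (rule Lim_null_comparison)
    show "eventually (\<lambda>m. norm (z m - inv H q) \<le> norm (H (z m) - q) / B) sequentially"
      using B(2)[of "z _ - inv H q"] B(1) bij_is_surj[OF H(2)]
      by (simp add: linear_diff[OF H(1)] surj_f_inv_f pos_le_divide_eq mult.commute)
    show "(\<lambda>m. norm (H (z m) - q) / B) \<longlonglongrightarrow> 0"
      using tendsto_divide[OF tendsto_norm[OF tendsto_diff[OF Hz tendsto_const[of q]]] tendsto_const[of B]] B(1) by simp
  qed
  then show ?thesis by (simp add: LIM_zero_iff z_def)
qed

section \<open>Scores of the three objective functions\<close>

text \<open>The log-likelihood and the importance sampling objective both have the form \<open>c(t) + v - e\<^sup>v f(t)\<close>; they differ only in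
\<open>f\<close>, which is the exact normalising constant ratio or its empirical average.\<close>

lemma has_derivative_loglik_shape:
  assumes c: "(c has_derivative (\<lambda>d. gc \<bullet> d)) (at t)" and f: "(f has_derivative (\<lambda>d. g \<bullet> d)) (at t)"
  shows "((\<lambda>(t, v). c t + v - exp v * f t) has_derivative (\<lambda>d. (gc - exp v *\<^sub>R g, 1 - exp v * f t) \<bullet> d)) (at (t, v))"
proof -
  have c': "((\<lambda>p. c (fst p)) has_derivative (\<lambda>d. gc \<bullet> fst d)) (at (t, v))"
    by (rule has_derivative_compose[of fst fst _ _ c]) (auto intro: derivative_intros c)
  have f': "((\<lambda>p. f (fst p)) has_derivative (\<lambda>d. g \<bullet> fst d)) (at (t, v))"
    by (rule has_derivative_compose[of fst fst _ _ f]) (auto intro: derivative_intros f)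
  show ?thesis
    unfolding case_prod_beta
    by (auto intro!: derivative_eq_intros c' f' simp: inner_prod_def algebra_simps inner_commute fun_eq_iff)
qed

lemma has_derivative_loglik_shape_gradient:
  assumes c: "(gc has_derivative Kc) (at t)" and g: "(g has_derivative K) (at t)"
    and f: "(f has_derivative (\<lambda>d. g t \<bullet> d)) (at t)"
  shows "((\<lambda>(t, v). (gc t - exp v *\<^sub>R g t, 1 - exp v * f t)) has_derivative
      (\<lambda>(a, b). (Kc a - exp v *\<^sub>R (K a + b *\<^sub>R g t), - (exp v * (g t \<bullet> a + b * f t))))) (at (t, v))"
proof -
  have c': "((\<lambda>p. gc (fst p)) has_derivative (\<lambda>d. Kc (fst d))) (at (t, v))"
    by (rule has_derivative_compose[of fst fst _ _ gc]) (auto intro: derivative_intros c)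
  have g': "((\<lambda>p. g (fst p)) has_derivative (\<lambda>d. K (fst d))) (at (t, v))"
    by (rule has_derivative_compose[of fst fst _ _ g]) (auto intro: derivative_intros g)
  have f': "((\<lambda>p. f (fst p)) has_derivative (\<lambda>d. g t \<bullet> fst d)) (at (t, v))"
    by (rule has_derivative_compose[of fst fst _ _ f]) (auto intro: derivative_intros f)
  show ?thesis
    unfolding case_prod_beta
    by (auto intro!: derivative_eq_intros c' f' g' simp: algebra_simps fun_eq_iff)
qed

text \<open>\<open>V\<close> is a neighbourhood of the maximum likelihood estimate on which all likelihood contributions of the observations
are positive and twice continuously differentiable.\<close>

locale observed_data =
  fixes V :: "'p::euclidean_space set" and \<theta>h :: 'p
    and h :: "'p \<Rightarrow> 'b \<Rightarrow> real" and h\<psi> :: "'b \<Rightarrow> real" and n :: nat and y :: "nat \<Rightarrow> 'b"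
  assumes V: "open V" "\<theta>h \<in> V" and n: "1 \<le> n"
    and y_C2: "\<And>i. i \<in> {1..n} \<Longrightarrow> C2_on V (\<lambda>t. h t (y i))"
    and y_pos: "\<And>i t. i \<in> {1..n} \<Longrightarrow> t \<in> V \<Longrightarrow> 0 < h t (y i)"
    and hpsi_y: "\<And>i. i \<in> {1..n} \<Longrightarrow> 0 < h\<psi> (y i)"
begin

abbreviation dh :: "'p \<Rightarrow> 'b \<Rightarrow> 'p" where "dh t x \<equiv> gradient (\<lambda>t. h t x) t"
abbreviation ddh :: "'p \<Rightarrow> 'b \<Rightarrow> 'p \<Rightarrow> 'p" where "ddh t x \<equiv> blinfun_apply (hessian (\<lambda>t. h t x) t)"

definition obs :: "'p \<Rightarrow> real" where
  "obs t = (1 / n) * (\<Sum>i=1..n. ln (h t (y i) / h\<psi> (y i)))"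
definition obs_grad :: "'p \<Rightarrow> 'p" where
  "obs_grad t = (1 / real n) *\<^sub>R (\<Sum>i=1..n. dh t (y i) /\<^sub>R h t (y i))"
definition obs_hess :: "'p \<Rightarrow> 'p \<Rightarrow> 'p" where
  "obs_hess t a = (1 / real n) *\<^sub>R (\<Sum>i=1..n. ddh t (y i) a /\<^sub>R h t (y i)
      - ((dh t (y i) \<bullet> a) / (h t (y i))\<^sup>2) *\<^sub>R dh t (y i))"

lemma obs_ln: "t \<in> V \<Longrightarrow> obs t = (1 / n) * (\<Sum>i=1..n. ln (h t (y i))) - (1 / n) * (\<Sum>i=1..n. ln (h\<psi> (y i)))"
  by (simp add: obs_def ln_divide_pos y_pos hpsi_y sum_subtractf right_diff_distrib)

lemma has_derivative_obs_ln:
  assumes t: "t \<in> V"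
  shows "((\<lambda>t. (1 / n) * (\<Sum>i=1..n. ln (h t (y i)))) has_derivative (\<lambda>a. obs_grad t \<bullet> a)) (at t)"
proof -
  have "((\<lambda>t. (1 / n) * (\<Sum>i=1..n. ln (h t (y i)))) has_derivative
      (\<lambda>a. (1 / n) * (\<Sum>i=1..n. (dh t (y i) /\<^sub>R h t (y i)) \<bullet> a))) (at t)"
    by (intro has_derivative_mult_right has_derivative_sum has_derivative_gradient_ln
        C2_on_has_derivative(1)[OF y_C2 t] y_pos t)
  then show ?thesis by (simp add: obs_grad_def inner_sum_left)
qed

lemma has_derivative_obs:
  assumes t: "t \<in> V"
  shows "(obs has_derivative (\<lambda>a. obs_grad t \<bullet> a)) (at t)"
proof -
  have "((\<lambda>t. (1 / n) * (\<Sum>i=1..n. ln (h t (y i))) - (1 / n) * (\<Sum>i=1..n. ln (h\<psi> (y i))))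
      has_derivative (\<lambda>a. obs_grad t \<bullet> a - 0)) (at t)"
    by (intro has_derivative_diff has_derivative_const has_derivative_obs_ln t)
  from has_derivative_transform_within_open[OF this V(1) t obs_ln[symmetric]] show ?thesis by simp
qed

lemma has_derivative_obs_grad:
  assumes t: "t \<in> V"
  shows "(obs_grad has_derivative obs_hess t) (at t)"
  unfolding obs_grad_def[abs_def] obs_hess_def[abs_def]
  by (intro has_derivative_scaleR_right has_derivative_sum has_derivative_scaled_gradient
      C2_on_has_derivative[OF y_C2 t] y_pos t)

lemma continuous_dh_ratio:
  assumes i: "i \<in> {1..n}"
  shows "continuous_on V (\<lambda>t. dh t (y i) /\<^sub>R h t (y i))"
  using y_pos[OF i] by (intro continuous_intros C2_on_continuous[OF y_C2[OF i]]) force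

lemma continuous_obs_hess: "continuous_on V (\<lambda>t. obs_hess t a)"
  unfolding obs_hess_def
  by (intro continuous_intros C2_on_continuous[OF y_C2]) (use y_pos in \<open>auto simp: less_imp_neq[symmetric]\<close>)

text \<open>The gradient of \<open>obs t + v - e\<^sup>v f(t)\<close> when \<open>g\<close> is the gradient of \<open>f\<close>.\<close>

definition score :: "('p \<Rightarrow> 'p) \<Rightarrow> ('p \<Rightarrow> real) \<Rightarrow> 'p \<times> real \<Rightarrow> 'p \<times> real" where
  "score g f = (\<lambda>(t, v). (obs_grad t - exp v *\<^sub>R g t, 1 - exp v * f t))"

text \<open>The derivative of \<open>score g f\<close> at \<open>(t, v)\<close>, where \<open>K\<close>, \<open>g\<close> and \<open>z\<close> stand for the second derivative, the gradient and the
value of \<open>f\<close> at \<open>t\<close>. Taking these as separate arguments allows both empirical averages and their limits to be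
inserted.\<close>

definition score_deriv :: "('p \<Rightarrow> 'p) \<Rightarrow> 'p \<Rightarrow> real \<Rightarrow> 'p \<times> real \<Rightarrow> 'p \<times> real \<Rightarrow> 'p \<times> real" where
  "score_deriv K g z = (\<lambda>(t, v) (a, b). (obs_hess t a - exp v *\<^sub>R (K a + b *\<^sub>R g), - (exp v * (g \<bullet> a + b * z))))"

lemma has_derivative_loglik_score:
  assumes t: "t \<in> V" and f: "(f has_derivative (\<lambda>d. g t \<bullet> d)) (at t)"
  shows "((\<lambda>(t, v). obs t + v - exp v * f t) has_derivative (\<lambda>d. score g f (t, v) \<bullet> d)) (at (t, v))"
  unfolding score_def prod.case by (rule has_derivative_loglik_shape[OF has_derivative_obs[OF t] f])

lemma has_derivative_score:
  assumes t: "t \<in> V" and f: "(f has_derivative (\<lambda>d. g t \<bullet> d)) (at t)" and g: "(g has_derivative K) (at t)"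
  shows "(score g f has_derivative score_deriv K (g t) (f t) (t, v)) (at (t, v))"
  unfolding score_def score_deriv_def prod.case
  by (rule has_derivative_loglik_shape_gradient[OF has_derivative_obs_grad[OF t] g f])

end

text \<open>One realisation of the artificial data. A value \<open>h\<psi> (x j) = 0\<close> is possible here; then the corresponding ratios are 0,
in the importance sampling and in the noise-contrastive objective alike.\<close>

locale realisation = observed_data V \<theta>h h h\<psi> n y
  for V :: "'p::euclidean_space set" and \<theta>h h and h\<psi> :: "'b \<Rightarrow> real" and n y +
  fixes x :: "nat \<Rightarrow> 'b"
  assumes x_C2: "\<And>j. 1 \<le> j \<Longrightarrow> C2_on V (\<lambda>t. h t (x j))"
    and x_nonneg: "\<And>j t. 1 \<le> j \<Longrightarrow> t \<in> V \<Longrightarrow> 0 \<le> h t (x j)"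
    and hpsi_x: "\<And>j. 1 \<le> j \<Longrightarrow> 0 \<le> h\<psi> (x j)"
begin

definition emp :: "nat \<Rightarrow> 'p \<Rightarrow> real" where
  "emp m t = (\<Sum>j=1..m. h t (x j) / h\<psi> (x j)) /\<^sub>R real m"
definition emp_grad :: "nat \<Rightarrow> 'p \<Rightarrow> 'p" where
  "emp_grad m t = (\<Sum>j=1..m. dh t (x j) /\<^sub>R h\<psi> (x j)) /\<^sub>R real m"
definition emp_hess :: "nat \<Rightarrow> 'p \<Rightarrow> 'p \<Rightarrow> 'p" where
  "emp_hess m t a = (\<Sum>j=1..m. ddh t (x j) a /\<^sub>R h\<psi> (x j)) /\<^sub>R real m"

lemma has_derivative_emp:
  assumes t: "t \<in> V"
  shows "(emp m has_derivative (\<lambda>a. emp_grad m t \<bullet> a)) (at t)"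
proof -
  have "((\<lambda>t. (\<Sum>j=1..m. h t (x j) /\<^sub>R h\<psi> (x j)) /\<^sub>R real m) has_derivative
      (\<lambda>a. (\<Sum>j=1..m. (dh t (x j) \<bullet> a) /\<^sub>R h\<psi> (x j)) /\<^sub>R real m)) (at t)"
    by (intro has_derivative_scaleR_right has_derivative_sum C2_on_has_derivative(1)[OF x_C2 t]) auto
  then show ?thesis
    by (simp add: emp_def[abs_def] emp_grad_def inner_sum_left divide_inverse mult.commute)
qed

lemma has_derivative_emp_grad:
  assumes t: "t \<in> V"
  shows "(emp_grad m has_derivative emp_hess m t) (at t)"
  unfolding emp_grad_def[abs_def] emp_hess_def[abs_def]
  by (intro has_derivative_scaleR_right has_derivative_sum C2_on_has_derivative(2)[OF x_C2 t]) auto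

lemma loglik_IS_eq: "loglik_IS h h\<psi> n y m x = (\<lambda>(t, v). obs t + v - exp v * emp m t)"
  by (auto simp: loglik_IS_def obs_def emp_def fun_eq_iff divide_inverse)

lemma gradient_IS:
  assumes t: "t \<in> V"
  shows "gradient (loglik_IS h h\<psi> n y m x) (t, v) = score (emp_grad m) (emp m) (t, v)"
  unfolding loglik_IS_eq
  by (rule gradient_eqI, rule has_derivative_loglik_score[OF t], rule has_derivative_emp[OF t])

lemma has_derivative_odds:
  assumes f: "((\<lambda>t. h t z) has_derivative (\<lambda>a. dh t z \<bullet> a)) (at t)"
  shows "((\<lambda>\<xi>. nce_odds h h\<psi> n m \<xi> z) has_derivative
      (\<lambda>d. ((real n / real m * exp v / h\<psi> z) *\<^sub>R (dh t z, h t z)) \<bullet> d)) (at (t, v))"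
proof -
  have f': "((\<lambda>p. h (fst p) z) has_derivative (\<lambda>d. dh t z \<bullet> fst d)) (at (t, v))"
    by (rule has_derivative_compose[of fst fst _ _ "\<lambda>t. h t z"]) (auto intro: derivative_intros f)
  have "((\<lambda>p. (h (fst p) z * k) * exp (snd p) * c) has_derivative
      (\<lambda>d. ((c * exp v * k) *\<^sub>R (dh t z, h t z)) \<bullet> d)) (at (t, v))" for c k
    by (auto intro!: derivative_eq_intros f' simp: inner_prod_def algebra_simps fun_eq_iff)
  from this[of "inverse (h\<psi> z)" "real n / real m"] show ?thesis
    by (simp add: nce_odds_def case_prod_beta divide_inverse)
qed

lemma DERIV_ln_odds:
  fixes u :: real
  assumes u: "0 < u"
  shows "((\<lambda>u. ln (u / (1 + u))) has_real_derivative 1 / (u * (1 + u))) (at u)"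
proof (rule has_field_derivative_transform_within_open[of "\<lambda>u. ln u - ln (1 + u)"])
  show "((\<lambda>u. ln u - ln (1 + u)) has_real_derivative 1 / (u * (1 + u))) (at u)"
    using u by (auto intro!: derivative_eq_intros simp: divide_simps)
  show "open {0::real<..}" "u \<in> {0<..}" using u by auto
qed (simp add: ln_divide_pos)

lemma DERIV_ln_one_minus_odds:
  fixes u :: real
  assumes u: "0 \<le> u"
  shows "((\<lambda>u. ln (1 - u / (1 + u))) has_real_derivative - (1 / (1 + u))) (at u)"
proof (rule has_field_derivative_transform_within_open[of "\<lambda>u. - ln (1 + u)"])
  show "((\<lambda>u. - ln (1 + u)) has_real_derivative - (1 / (1 + u))) (at u)"
    using u by (auto intro!: derivative_eq_intros)
  show "open {- 1::real<..}" "u \<in> {- 1<..}" using u by auto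
  fix z :: real assume "z \<in> {- 1<..}"
  then have "1 - z / (1 + z) = inverse (1 + z)" by (simp add: field_simps)
  then show "- ln (1 + z) = ln (1 - z / (1 + z))" by (simp add: ln_inverse)
qed

lemma gradient_NCE:
  fixes v :: real
  assumes t: "t \<in> V" and m: "1 \<le> m"
  defines "odds \<equiv> \<lambda>z. nce_odds h h\<psi> n m (t, v) z"
  shows "gradient (loglik_NCE h h\<psi> n y m x) (t, v) =
      (\<Sum>i=1..n. (1 / (1 + odds (y i))) *\<^sub>R (dh t (y i) /\<^sub>R h t (y i), 1))
      - (\<Sum>j=1..m. (1 / (1 + odds (x j))) *\<^sub>R ((real n / real m * exp v / h\<psi> (x j)) *\<^sub>R (dh t (x j), h t (x j))))"
    (is "_ = ?G")
proof (rule gradient_eqI)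
  have Y: "((\<lambda>\<xi>. ln (nce_q h h\<psi> n m \<xi> (y i))) has_derivative
      (\<lambda>d. ((1 / (1 + odds (y i))) *\<^sub>R (dh t (y i) /\<^sub>R h t (y i), 1::real)) \<bullet> d)) (at (t, v))" if i: "i \<in> {1..n}" for i
  proof -
    have pos: "0 < h t (y i)" "0 < h\<psi> (y i)" using y_pos[OF i t] hpsi_y[OF i] .
    have o: "0 < odds (y i)" using pos n m by (simp add: odds_def nce_odds_def)
    define w where "w = (dh t (y i) /\<^sub>R h t (y i), 1::real)"
    have eq: "(real n / real m * exp v / h\<psi> (y i)) *\<^sub>R (dh t (y i), h t (y i)) = odds (y i) *\<^sub>R w"
      using pos by (simp add: w_def odds_def nce_odds_def field_simps)
    note D = has_derivative_odds[OF C2_on_has_derivative(1)[OF y_C2[OF i] t], of m v, unfolded eq]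
    have "((\<lambda>u. ln (u / (1 + u))) has_real_derivative 1 / (odds (y i) * (1 + odds (y i)))) (at (nce_odds h h\<psi> n m (t, v) (y i)))"
      using DERIV_ln_odds[OF o] by (simp add: odds_def)
    from DERIV_compose_FDERIV[OF this D] show ?thesis
      unfolding w_def[symmetric] nce_q_def using o by simp
  qed
  have X: "((\<lambda>\<xi>. ln (1 - nce_q h h\<psi> n m \<xi> (x j))) has_derivative
      (\<lambda>d. - (((1 / (1 + odds (x j))) *\<^sub>R ((real n / real m * exp v / h\<psi> (x j)) *\<^sub>R (dh t (x j), h t (x j)))) \<bullet> d))) (at (t, v))"
    if j: "1 \<le> j" for j
  proof -
    have o: "0 \<le> odds (x j)" using x_nonneg[OF j t] hpsi_x[OF j] by (simp add: odds_def nce_odds_def)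
    define w where "w = (real n / real m * exp v / h\<psi> (x j)) *\<^sub>R (dh t (x j), h t (x j))"
    note D = has_derivative_odds[OF C2_on_has_derivative(1)[OF x_C2[OF j] t], of m v, folded w_def]
    have "((\<lambda>u. ln (1 - u / (1 + u))) has_real_derivative - (1 / (1 + odds (x j)))) (at (nce_odds h h\<psi> n m (t, v) (x j)))"
      using DERIV_ln_one_minus_odds[OF o] by (simp add: odds_def)
    from DERIV_compose_FDERIV[OF this D] show ?thesis
      unfolding w_def[symmetric] nce_q_def by simp
  qed
  have "(loglik_NCE h h\<psi> n y m x has_derivative (\<lambda>d. (\<Sum>i=1..n. ((1 / (1 + odds (y i))) *\<^sub>R (dh t (y i) /\<^sub>R h t (y i), 1)) \<bullet> d)
      + (\<Sum>j=1..m. - (((1 / (1 + odds (x j))) *\<^sub>R ((real n / real m * exp v / h\<psi> (x j)) *\<^sub>R (dh t (x j), h t (x j)))) \<bullet> d)))) (at (t, v))"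
    unfolding loglik_NCE_def[abs_def] by (intro has_derivative_add has_derivative_sum X Y) auto
  then show "(loglik_NCE h h\<psi> n y m x has_derivative (\<lambda>d. ?G \<bullet> d)) (at (t, v))"
    by (simp add: inner_sum_left inner_diff_left sum_negf)
qed

text \<open>This is \<open>r (\<nabla>r, r) / (1 + \<bar>\<tau>\<bar> r)\<close> with \<open>r = h / h\<psi>\<close>. With \<open>\<tau> = (n / m) e\<^sup>v\<close> it is the contribution of an artificial point to the
difference of the two gradients, up to a factor that is the same for all points. Treating \<open>\<tau>\<close> as a free parameter turns the dependence of this
contribution on \<open>m\<close> into a dependence on a point near \<open>\<tau> = 0\<close>; the absolute value keeps the denominator positive on a
whole neighbourhood of 0.\<close>

definition damped_square :: "'p \<times> real \<Rightarrow> 'b \<Rightarrow> 'p \<times> real" where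
  "damped_square = (\<lambda>(t, \<tau>) z. (1 / (1 + \<bar>\<tau>\<bar> * (h t z / h\<psi> z))) *\<^sub>R ((h t z / h\<psi> z) *\<^sub>R (dh t z /\<^sub>R h\<psi> z, h t z / h\<psi> z)))"

definition emp_damped_square :: "nat \<Rightarrow> 'p \<times> real \<Rightarrow> 'p \<times> real" where
  "emp_damped_square m p = (\<Sum>j=1..m. damped_square p (x j)) /\<^sub>R real m"

text \<open>The gap between the two gradients, rescaled by \<open>m / n\<close>. Along sequences of parameters that tend to the maximum likelihood
estimate it converges to the vector \<open>v\<close>.\<close>

definition bias :: "nat \<Rightarrow> 'p \<times> real \<Rightarrow> 'p \<times> real" where
  "bias m = (\<lambda>(t, v). (1 / real n) *\<^sub>R (\<Sum>i=1..n.
      ((h t (y i) / h\<psi> (y i) * exp v) / (1 + nce_odds h h\<psi> n m (t, v) (y i))) *\<^sub>R (dh t (y i) /\<^sub>R h t (y i), 1))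
    - exp (2 * v) *\<^sub>R emp_damped_square m (t, real n / real m * exp v))"

text \<open>Each summand of the noise-contrastive gradient is the corresponding importance sampling summand times \<open>1 / (1 + \<tau> r)\<close>.
The identity \<open>1 - 1 / (1 + \<tau> r) = \<tau> r / (1 + \<tau> r)\<close> extracts the common factor \<open>n / m\<close> from \<open>\<tau>\<close>.\<close>

lemma score_minus_NCE_gradient:
  assumes t: "t \<in> V" and m: "1 \<le> m"
  shows "score (emp_grad m) (emp m) (t, v) - (1 / real n) *\<^sub>R gradient (loglik_NCE h h\<psi> n y m x) (t, v)
    = (real n / real m) *\<^sub>R bias m (t, v)"
proof -
  define Y where "Y i = (dh t (y i) /\<^sub>R h t (y i), 1::real)" for i
  define X where "X j = (dh t (x j) /\<^sub>R h\<psi> (x j), h t (x j) / h\<psi> (x j))" for j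
  define r where "r z = h t z / h\<psi> z" for z
  define \<tau> where "\<tau> = real n / real m * exp v"
  have odds_eq: "nce_odds h h\<psi> n m (t, v) z = \<tau> * r z" for z
    by (simp add: nce_odds_def r_def \<tau>_def mult_ac)
  have \<tau>: "0 < \<tau>" using n m by (simp add: \<tau>_def)
  have r: "0 \<le> r (y i)" if "i \<in> {1..n}" for i
    using y_pos[OF that t] hpsi_y[OF that] by (simp add: r_def)
  have r': "0 \<le> r (x j)" if "j \<in> {1..m}" for j
    using x_nonneg[OF _ t] hpsi_x that by (simp add: r_def)
  have S: "score (emp_grad m) (emp m) (t, v) = (\<Sum>i=1..n. (1 / real n) *\<^sub>R Y i) - (\<Sum>j=1..m. (exp v / real m) *\<^sub>R X j)"
    using n by (auto simp: score_def obs_grad_def emp_def emp_grad_def Y_def X_def fst_sum snd_sum scaleR_sum_right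
        divide_inverse sum_distrib_left mult.assoc intro!: prod_eqI)
  have N: "gradient (loglik_NCE h h\<psi> n y m x) (t, v)
      = (\<Sum>i=1..n. (1 / (1 + \<tau> * r (y i))) *\<^sub>R Y i) - (\<Sum>j=1..m. (1 / (1 + \<tau> * r (x j)) * \<tau>) *\<^sub>R X j)"
    unfolding gradient_NCE[OF t m] odds_eq Y_def X_def \<tau>_def
    by (simp add: divide_inverse mult_ac)
  have B: "bias m (t, v) = (\<Sum>i=1..n. (1 / real n * (r (y i) * exp v / (1 + \<tau> * r (y i)))) *\<^sub>R Y i)
      - (\<Sum>j=1..m. (exp (2 * v) / real m * (r (x j) / (1 + \<tau> * r (x j)))) *\<^sub>R X j)"
    unfolding bias_def prod.case odds_eq \<tau>_def[symmetric] emp_damped_square_def damped_square_def abs_of_pos[OF \<tau>]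
    by (simp add: Y_def X_def r_def scaleR_sum_right divide_inverse mult_ac)
  have "score (emp_grad m) (emp m) (t, v) - (1 / real n) *\<^sub>R gradient (loglik_NCE h h\<psi> n y m x) (t, v)
      = (\<Sum>i=1..n. (1 / real n - 1 / real n * (1 / (1 + \<tau> * r (y i)))) *\<^sub>R Y i)
      - (\<Sum>j=1..m. (exp v / real m - 1 / real n * (1 / (1 + \<tau> * r (x j)) * \<tau>)) *\<^sub>R X j)"
    unfolding S N by (simp add: scaleR_diff_left scaleR_diff_right sum_subtractf scaleR_sum_right)
  also have "(\<Sum>i=1..n. (1 / real n - 1 / real n * (1 / (1 + \<tau> * r (y i)))) *\<^sub>R Y i)
      = (real n / real m) *\<^sub>R (\<Sum>i=1..n. (1 / real n * (r (y i) * exp v / (1 + \<tau> * r (y i)))) *\<^sub>R Y i)"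
  proof -
    have "1 / real n - 1 / real n * (1 / (1 + \<tau> * r (y i))) = real n / real m * (1 / real n * (r (y i) * exp v / (1 + \<tau> * r (y i))))"
      if "i \<in> {1..n}" for i
    proof -
      have "0 < 1 + \<tau> * r (y i)" using \<tau> r[OF that] by (simp add: add_pos_nonneg)
      then have "1 - 1 / (1 + \<tau> * r (y i)) = \<tau> * r (y i) / (1 + \<tau> * r (y i))" by (simp add: field_simps)
      moreover have "1 / real n - 1 / real n * (1 / (1 + \<tau> * r (y i))) = 1 / real n * (1 - 1 / (1 + \<tau> * r (y i)))"
        by (simp add: right_diff_distrib)
      ultimately show ?thesis by (simp add: \<tau>_def)
    qed
    then show ?thesis unfolding scaleR_sum_right by (intro sum.cong refl) simp
  qed
  also have "(\<Sum>j=1..m. (exp v / real m - 1 / real n * (1 / (1 + \<tau> * r (x j)) * \<tau>)) *\<^sub>R X j)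
      = (real n / real m) *\<^sub>R (\<Sum>j=1..m. (exp (2 * v) / real m * (r (x j) / (1 + \<tau> * r (x j)))) *\<^sub>R X j)"
  proof -
    have "exp v / real m - 1 / real n * (1 / (1 + \<tau> * r (x j)) * \<tau>) = real n / real m * (exp (2 * v) / real m * (r (x j) / (1 + \<tau> * r (x j))))"
      if "j \<in> {1..m}" for j
    proof -
      have "0 < 1 + \<tau> * r (x j)" using \<tau> r'[OF that] by (simp add: add_pos_nonneg)
      then have "1 - 1 / (1 + \<tau> * r (x j)) = \<tau> * r (x j) / (1 + \<tau> * r (x j))" by (simp add: field_simps)
      moreover have "exp v / real m - 1 / real n * (1 / (1 + \<tau> * r (x j)) * \<tau>) = exp v / real m * (1 - 1 / (1 + \<tau> * r (x j)))"
        using n by (simp add: right_diff_distrib \<tau>_def)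
      moreover have "exp (2 * v) = exp v * exp v" by (simp flip: exp_add)
      ultimately show ?thesis by (simp add: \<tau>_def)
    qed
    then show ?thesis unfolding scaleR_sum_right by (intro sum.cong refl) simp
  qed
  finally show ?thesis unfolding B by (simp add: scaleR_diff_right)
qed

text \<open>The argument for a single realisation: \<open>tendsto_scaled_difference\<close> is applied to the importance sampling score, whose
value at the noise-contrastive estimator is known from \<open>score_minus_NCE_gradient\<close>.\<close>

lemma estimator_difference_limit:
  assumes conv: "\<xi>IS \<longlonglongrightarrow> (\<theta>h, \<nu>h)" "\<xi>NCE \<longlonglongrightarrow> (\<theta>h, \<nu>h)"
    and small: "(\<lambda>m. real m *\<^sub>R gradient (loglik_IS h h\<psi> n y m x) (\<xi>IS m)) \<longlonglongrightarrow> 0"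
      "(\<lambda>m. real m *\<^sub>R gradient (loglik_NCE h h\<psi> n y m x) (\<xi>NCE m)) \<longlonglongrightarrow> 0"
    and emp: "((\<lambda>(m, t). emp m t) \<longlongrightarrow> z0) (sequentially \<times>\<^sub>F nhds \<theta>h)"
    and emp_grad: "((\<lambda>(m, t). emp_grad m t) \<longlongrightarrow> g0) (sequentially \<times>\<^sub>F nhds \<theta>h)"
    and emp_hess: "\<And>b. b \<in> Basis \<Longrightarrow> ((\<lambda>(m, t). emp_hess m t b) \<longlongrightarrow> K0 b) (sequentially \<times>\<^sub>F nhds \<theta>h)"
    and K0: "linear K0"
    and emp_damped_square: "((\<lambda>(m, p). emp_damped_square m p) \<longlongrightarrow> q0) (sequentially \<times>\<^sub>F nhds (\<theta>h, 0))"
    and H: "linear (score_deriv K0 g0 z0 (\<theta>h, \<nu>h))" "bij (score_deriv K0 g0 z0 (\<theta>h, \<nu>h))"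
  shows "(\<lambda>m. real m *\<^sub>R (\<xi>IS m - \<xi>NCE m)) \<longlonglongrightarrow> inv (score_deriv K0 g0 z0 (\<theta>h, \<nu>h))
      (- (real n *\<^sub>R ((1 / real n) *\<^sub>R (\<Sum>i=1..n.
          (h \<theta>h (y i) / h\<psi> (y i) * exp \<nu>h) *\<^sub>R (dh \<theta>h (y i) /\<^sub>R h \<theta>h (y i), 1)) - exp (2 * \<nu>h) *\<^sub>R q0)))"
    (is "_ \<longlonglongrightarrow> inv _ (- (real n *\<^sub>R ?v))")
proof (rule tendsto_scaled_difference[where W = "V \<times> UNIV" and \<xi> = "(\<theta>h, \<nu>h)"
    and T = "\<lambda>m. score (emp_grad m) (emp m)"
    and DT = "\<lambda>m \<xi>. score_deriv (emp_hess m (fst \<xi>)) (emp_grad m (fst \<xi>)) (emp m (fst \<xi>)) \<xi>"])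
  show "open (V \<times> (UNIV :: real set))" "(\<theta>h, \<nu>h) \<in> V \<times> UNIV" using V by (auto intro: open_Times)
  show "(score (emp_grad m) (emp m) has_derivative
      score_deriv (emp_hess m (fst \<xi>)) (emp_grad m (fst \<xi>)) (emp m (fst \<xi>)) \<xi>) (at \<xi>)" if "\<xi> \<in> V \<times> UNIV" for m \<xi>
    using has_derivative_score[OF _ has_derivative_emp has_derivative_emp_grad] that by (cases \<xi>) auto
  let ?F = "sequentially \<times>\<^sub>F nhds (\<theta>h, \<nu>h)"
  have fst_lim: "((\<lambda>m\<xi>. fst (snd m\<xi>)) \<longlongrightarrow> fst (\<theta>h, \<nu>h)) ?F" and snd_lim: "((\<lambda>m\<xi>. snd (snd m\<xi>)) \<longlongrightarrow> snd (\<theta>h, \<nu>h)) ?F"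
    by (intro tendsto_intros filterlim_snd)+
  then have P: "filterlim (\<lambda>m\<xi>. (fst m\<xi>, fst (snd m\<xi>))) (sequentially \<times>\<^sub>F nhds \<theta>h) ?F"
    by (intro filterlim_Pair filterlim_fst) simp
  have emp_hess': "((\<lambda>(m, t). emp_hess m t a) \<longlongrightarrow> K0 a) (sequentially \<times>\<^sub>F nhds \<theta>h)" for a
  proof -
    have lin: "linear (emp_hess m t)" for m t
      by (rule linearI) (simp_all add: emp_hess_def blinfun.add_right blinfun.scaleR_right scaleR_add_right
          sum.distrib scaleR_sum_right mult_ac)
    have "((\<lambda>mt. \<Sum>b\<in>Basis. (a \<bullet> b) *\<^sub>R (case mt of (m, t) \<Rightarrow> emp_hess m t b)) \<longlongrightarrow> (\<Sum>b\<in>Basis. (a \<bullet> b) *\<^sub>R K0 b))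
        (sequentially \<times>\<^sub>F nhds \<theta>h)"
      by (intro tendsto_intros emp_hess)
    moreover have "L a = (\<Sum>b\<in>Basis. (a \<bullet> b) *\<^sub>R L b)" if "linear L" for L :: "'p \<Rightarrow> 'p"
      using linear_sum[OF that, of "\<lambda>b. (a \<bullet> b) *\<^sub>R b" Basis] by (simp add: linear_cmul[OF that] euclidean_representation)
    ultimately show ?thesis using K0 lin by (simp add: case_prod_unfold)
  qed
  have obs_lim: "((\<lambda>m\<xi>. obs_hess (fst (snd m\<xi>)) a) \<longlongrightarrow> obs_hess \<theta>h a) ?F" for a
  proof -
    have "isCont (\<lambda>t. obs_hess t a) \<theta>h"
      using continuous_obs_hess V continuous_on_eq_continuous_at by blast
    from isCont_tendsto_compose[OF this] fst_lim show ?thesis by simp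
  qed
  show "((\<lambda>(m, \<xi>). score_deriv (emp_hess m (fst \<xi>)) (emp_grad m (fst \<xi>)) (emp m (fst \<xi>)) \<xi> d)
      \<longlongrightarrow> score_deriv K0 g0 z0 (\<theta>h, \<nu>h) d) ?F" for d
  proof -
    have "((\<lambda>m\<xi>. (obs_hess (fst (snd m\<xi>)) (fst d) - exp (snd (snd m\<xi>)) *\<^sub>R (emp_hess (fst m\<xi>) (fst (snd m\<xi>)) (fst d)
          + snd d *\<^sub>R emp_grad (fst m\<xi>) (fst (snd m\<xi>))),
        - (exp (snd (snd m\<xi>)) * (emp_grad (fst m\<xi>) (fst (snd m\<xi>)) \<bullet> fst d + snd d * emp (fst m\<xi>) (fst (snd m\<xi>))))))
      \<longlongrightarrow> (obs_hess \<theta>h (fst d) - exp (snd (\<theta>h, \<nu>h)) *\<^sub>R (K0 (fst d) + snd d *\<^sub>R g0),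
        - (exp (snd (\<theta>h, \<nu>h)) * (g0 \<bullet> fst d + snd d * z0)))) ?F"
      using filterlim_compose[OF emp P] filterlim_compose[OF emp_grad P] filterlim_compose[OF emp_hess' P] snd_lim
      by (intro tendsto_Pair tendsto_diff tendsto_scaleR tendsto_add tendsto_mult tendsto_minus tendsto_inner
          tendsto_const tendsto_exp obs_lim) simp_all
    then show ?thesis by (simp add: score_deriv_def case_prod_unfold)
  qed
  show "linear (score_deriv K0 g0 z0 (\<theta>h, \<nu>h))" "bij (score_deriv K0 g0 z0 (\<theta>h, \<nu>h))" by fact+
  show "\<xi>IS \<longlonglongrightarrow> (\<theta>h, \<nu>h)" "\<xi>NCE \<longlonglongrightarrow> (\<theta>h, \<nu>h)" by fact+
  have fstN: "(\<lambda>m. fst (\<xi>NCE m)) \<longlonglongrightarrow> \<theta>h" and sndN: "(\<lambda>m. snd (\<xi>NCE m)) \<longlonglongrightarrow> \<nu>h"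
    using tendsto_fst[OF conv(2)] tendsto_snd[OF conv(2)] by simp_all
  have inv_m: "(\<lambda>m. real n / real m) \<longlonglongrightarrow> 0" by (rule lim_const_over_n)
  have bias: "(\<lambda>m. bias m (\<xi>NCE m)) \<longlonglongrightarrow> ?v"
  proof -
    have "(\<lambda>m. (fst (\<xi>NCE m), real n / real m * exp (snd (\<xi>NCE m)))) \<longlonglongrightarrow> (\<theta>h, 0 * exp \<nu>h)"
      by (intro tendsto_intros fstN sndN inv_m)
    then have "filterlim (\<lambda>m. (m, (fst (\<xi>NCE m), real n / real m * exp (snd (\<xi>NCE m))))) (sequentially \<times>\<^sub>F nhds (\<theta>h, 0)) sequentially"
      by (intro filterlim_Pair filterlim_ident) simp
    from filterlim_compose[OF emp_damped_square this]
    have square_lim: "(\<lambda>m. emp_damped_square m (fst (\<xi>NCE m), real n / real m * exp (snd (\<xi>NCE m)))) \<longlonglongrightarrow> q0" by simp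
    have h_lim: "(\<lambda>m. h (fst (\<xi>NCE m)) (y i)) \<longlonglongrightarrow> h \<theta>h (y i)"
      and g_lim: "(\<lambda>m. dh (fst (\<xi>NCE m)) (y i) /\<^sub>R h (fst (\<xi>NCE m)) (y i)) \<longlonglongrightarrow> dh \<theta>h (y i) /\<^sub>R h \<theta>h (y i)"
      if i: "i \<in> {1..n}" for i
    proof -
      have "isCont (\<lambda>t. h t (y i)) \<theta>h" "isCont (\<lambda>t. dh t (y i) /\<^sub>R h t (y i)) \<theta>h"
        using C2_on_continuous(1)[OF y_C2[OF i]] continuous_dh_ratio[OF i] V continuous_on_eq_continuous_at by blast+
      from this[THEN isCont_tendsto_compose, OF fstN]
      show "(\<lambda>m. h (fst (\<xi>NCE m)) (y i)) \<longlonglongrightarrow> h \<theta>h (y i)"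
        "(\<lambda>m. dh (fst (\<xi>NCE m)) (y i) /\<^sub>R h (fst (\<xi>NCE m)) (y i)) \<longlonglongrightarrow> dh \<theta>h (y i) /\<^sub>R h \<theta>h (y i)" .
    qed
    have "(\<lambda>m. (1 / real n) *\<^sub>R (\<Sum>i=1..n.
          ((h (fst (\<xi>NCE m)) (y i) / h\<psi> (y i) * exp (snd (\<xi>NCE m)))
            / (1 + h (fst (\<xi>NCE m)) (y i) / h\<psi> (y i) * exp (snd (\<xi>NCE m)) * (real n / real m)))
            *\<^sub>R (dh (fst (\<xi>NCE m)) (y i) /\<^sub>R h (fst (\<xi>NCE m)) (y i), 1))
        - exp (2 * snd (\<xi>NCE m)) *\<^sub>R emp_damped_square m (fst (\<xi>NCE m), real n / real m * exp (snd (\<xi>NCE m))))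
      \<longlonglongrightarrow> (1 / real n) *\<^sub>R (\<Sum>i=1..n.
          ((h \<theta>h (y i) / h\<psi> (y i) * exp \<nu>h) / (1 + h \<theta>h (y i) / h\<psi> (y i) * exp \<nu>h * 0)) *\<^sub>R (dh \<theta>h (y i) /\<^sub>R h \<theta>h (y i), 1))
        - exp (2 * \<nu>h) *\<^sub>R q0"
      using hpsi_y
      by (intro tendsto_intros square_lim h_lim g_lim sndN inv_m) (auto simp: less_imp_neq[symmetric])
    then show ?thesis by (simp add: bias_def nce_odds_def case_prod_beta)
  qed
  have "eventually (\<lambda>m. \<xi>IS m \<in> V \<times> UNIV) sequentially" "eventually (\<lambda>m. \<xi>NCE m \<in> V \<times> UNIV) sequentially"
    using topological_tendstoD[OF conv(1), of "V \<times> UNIV"] topological_tendstoD[OF conv(2), of "V \<times> UNIV"] V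
    by (auto intro: open_Times)
  then have "eventually (\<lambda>m. real m *\<^sub>R gradient (loglik_IS h h\<psi> n y m x) (\<xi>IS m)
      - (1 / real n) *\<^sub>R (real m *\<^sub>R gradient (loglik_NCE h h\<psi> n y m x) (\<xi>NCE m)) - real n *\<^sub>R bias m (\<xi>NCE m)
      = real m *\<^sub>R (score (emp_grad m) (emp m) (\<xi>IS m) - score (emp_grad m) (emp m) (\<xi>NCE m))) sequentially"
    using eventually_ge_at_top[of 1]
  proof eventually_elim
    case (elim m)
    have 1: "gradient (loglik_IS h h\<psi> n y m x) (\<xi>IS m) = score (emp_grad m) (emp m) (\<xi>IS m)"
      using gradient_IS elim(1) by (metis mem_Times_iff prod.collapse)
    have 2: "score (emp_grad m) (emp m) (\<xi>NCE m)
        = (1 / real n) *\<^sub>R gradient (loglik_NCE h h\<psi> n y m x) (\<xi>NCE m) + (real n / real m) *\<^sub>R bias m (\<xi>NCE m)"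
      using score_minus_NCE_gradient[of "fst (\<xi>NCE m)" m "snd (\<xi>NCE m)"] elim(2,3)
      by (simp add: mem_Times_iff diff_eq_eq add.commute)
    show ?case unfolding 1 2 using elim(3) by (simp add: scaleR_diff_right scaleR_add_right)
  qed
  moreover have "(\<lambda>m. real m *\<^sub>R gradient (loglik_IS h h\<psi> n y m x) (\<xi>IS m)
      - (1 / real n) *\<^sub>R (real m *\<^sub>R gradient (loglik_NCE h h\<psi> n y m x) (\<xi>NCE m)) - real n *\<^sub>R bias m (\<xi>NCE m))
      \<longlonglongrightarrow> 0 - (1 / real n) *\<^sub>R 0 - real n *\<^sub>R ?v"
    by (intro tendsto_intros small bias)
  ultimately show "(\<lambda>m. real m *\<^sub>R (score (emp_grad m) (emp m) (\<xi>IS m) - score (emp_grad m) (emp m) (\<xi>NCE m)))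
      \<longlonglongrightarrow> - (real n *\<^sub>R ?v)"
    using Lim_transform_eventually by fastforce
qed

end

text \<open>With \<open>exp v * Z = 1\<close> the second component of \<open>score_deriv K g Z (t, v) (a, b) = 0\<close> gives \<open>b = - (g \<bullet> a) / Z\<close>. Inserted into the first component it
leaves the Schur complement, which is the map assumed to be injective; for the log-likelihood this is the Hessian
of the profile log-likelihood in \<open>t\<close>.\<close>

lemma (in observed_data) bij_score_deriv:
  assumes lin: "linear (score_deriv K g Z (t, v))" and Z: "exp v * Z = 1"
    and inj: "inj (\<lambda>a. obs_hess t a - (K a /\<^sub>R Z - ((g \<bullet> a) / Z\<^sup>2) *\<^sub>R g))"
    and K: "linear K"
  shows "bij (score_deriv K g Z (t, v))"
proof -
  have Z0: "0 < Z" using Z by (metis exp_gt_zero zero_less_mult_pos zero_less_one)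
  have e: "exp v = 1 / Z" using Z Z0 by (simp add: field_simps)
  have "ab = 0" if "score_deriv K g Z (t, v) ab = 0" for ab
  proof -
    obtain a b where ab: "ab = (a, b)" by (cases ab)
    have 1: "obs_hess t a - (1 / Z) *\<^sub>R (K a + b *\<^sub>R g) = 0" and 2: "g \<bullet> a + b * Z = 0"
      using that Z0 by (simp_all add: score_deriv_def ab e zero_prod_def)
    have b: "b = - ((g \<bullet> a) / Z)" using 2 Z0 by (simp add: field_simps)
    have "obs_hess t a - (K a /\<^sub>R Z - ((g \<bullet> a) / Z\<^sup>2) *\<^sub>R g) = 0"
      using 1 by (simp add: b divide_inverse power2_eq_square algebra_simps)
    moreover have "obs_hess t 0 - (K 0 /\<^sub>R Z - ((g \<bullet> 0) / Z\<^sup>2) *\<^sub>R g) = 0"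
      using linear_0[OF K] by (simp add: obs_hess_def)
    ultimately have "a = 0" using injD[OF inj, of a 0] by simp
    then show ?thesis by (simp add: ab b zero_prod_def)
  qed
  then have "inj (score_deriv K g Z (t, v))" using linear_injective_0[OF lin] by blast
  then show ?thesis using linear_injective_imp_surjective[OF lin] by (simp add: bij_def)
qed

section \<open>Densities, expectations and the maximiser\<close>

text \<open>The integral of a function \<open>g\<close> that is not measurable is a lower integral, for which the density formula is not
available as an equation. Every simple function below \<open>g\<close> is measurable, and this gives the inequality.\<close>

lemma nn_integral_density_le:
  fixes g w :: "'a \<Rightarrow> ennreal"
  assumes u: "u \<in> borel_measurable M" and r: "0 < r"
    and le: "\<And>x. x \<in> space M \<Longrightarrow> u x * g x \<le> ennreal r * w x"
  shows "(\<integral>\<^sup>+x. g x \<partial>density M u) \<le> ennreal r * (\<integral>\<^sup>+x. w x \<partial>M)"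
  unfolding nn_integral_def[of "density M u"]
proof (rule SUP_least, clarify)
  fix s assume s: "simple_function (density M u) s" "s \<le> g"
  have sm: "s \<in> borel_measurable M" using borel_measurable_simple_function[OF s(1)] by simp
  have one: "ennreal r * (ennreal (1 / r) * a) = a" "ennreal (1 / r) * (ennreal r * a) = a" for a
    using r by (simp_all add: mult.assoc[symmetric] flip: ennreal_mult)
  have "integral\<^sup>S (density M u) s = (\<integral>\<^sup>+x. s x \<partial>density M u)"
    using s(1) by (rule nn_integral_eq_simple_integral[symmetric])
  also have "\<dots> = (\<integral>\<^sup>+x. u x * s x \<partial>M)" by (rule nn_integral_density[OF u sm])
  also have "\<dots> = (\<integral>\<^sup>+x. ennreal r * (ennreal (1 / r) * (u x * s x)) \<partial>M)" by (simp only: one)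
  also have "\<dots> = ennreal r * (\<integral>\<^sup>+x. ennreal (1 / r) * (u x * s x) \<partial>M)"
    by (rule nn_integral_cmult) (use u sm in simp)
  also have "\<dots> \<le> ennreal r * (\<integral>\<^sup>+x. w x \<partial>M)"
  proof (intro mult_left_mono nn_integral_mono)
    fix x assume x: "x \<in> space M"
    have "u x * s x \<le> ennreal r * w x"
      using le[OF x] mult_left_mono[of "s x" "g x" "u x"] s(2) by (auto simp: le_fun_def intro: order_trans)
    then have "ennreal (1 / r) * (u x * s x) \<le> ennreal (1 / r) * (ennreal r * w x)"
      by (rule mult_left_mono) simp
    then show "ennreal (1 / r) * (u x * s x) \<le> w x" by (simp only: one)
  qed simp
  finally show "integral\<^sup>S (density M u) s \<le> ennreal r * (\<integral>\<^sup>+x. w x \<partial>M)" .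
qed

text \<open>The set where \<open>g\<close> vanishes is null for the distribution with density proportional to \<open>g\<close>, hence for the one proportional to
\<open>f\<close>. So \<open>f\<close> loses no mass when it is divided and multiplied by \<open>g\<close>.\<close>

lemma norm_const_ratio:
  assumes f: "f \<in> borel_measurable \<mu>" and g: "g \<in> borel_measurable \<mu>" "\<And>x. x \<in> space \<mu> \<Longrightarrow> 0 \<le> g x"
    and f_nonneg: "\<And>x. x \<in> space \<mu> \<Longrightarrow> 0 \<le> f x"
    and Z: "0 < norm_const \<mu> f" "0 < norm_const \<mu> g"
    and ac: "absolutely_continuous (unnorm_prob \<mu> g) (unnorm_prob \<mu> f)"
  shows "norm_const \<mu> f / norm_const \<mu> g = (\<integral>x. f x / g x \<partial>unnorm_prob \<mu> g)"
proof -
  define A where "A = {x \<in> space \<mu>. g x = 0}"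
  have A: "A \<in> sets \<mu>" using g(1) unfolding A_def by measurable
  have "A \<in> null_sets (unnorm_prob \<mu> g)"
    unfolding unnorm_prob_def by (subst null_sets_density_iff) (use g A in \<open>auto simp: A_def\<close>)
  then have "A \<in> null_sets (unnorm_prob \<mu> f)" using ac by (auto simp: absolutely_continuous_def)
  then have "AE x in \<mu>. x \<in> A \<longrightarrow> ennreal (f x / norm_const \<mu> f) = 0"
    unfolding unnorm_prob_def by (subst (asm) null_sets_density_iff) (use f in auto)
  then have *: "AE x in \<mu>. g x = 0 \<longrightarrow> f x = 0"
    using AE_space by eventually_elim (use Z f_nonneg in \<open>auto simp: A_def ennreal_eq_0_iff divide_le_0_iff antisym\<close>)
  have "(\<integral>x. f x / g x \<partial>unnorm_prob \<mu> g) = (\<integral>x. (g x / norm_const \<mu> g) *\<^sub>R (f x / g x) \<partial>\<mu>)"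
    unfolding unnorm_prob_def by (rule integral_density) (use f g Z in \<open>auto intro!: AE_I2\<close>)
  also have "\<dots> = (\<integral>x. f x / norm_const \<mu> g \<partial>\<mu>)"
    by (rule integral_cong_AE) (use f g * in \<open>auto elim!: eventually_mono\<close>)
  finally show ?thesis by (simp add: norm_const_def)
qed

lemma borel_measurable_completion_AE_eq:
  fixes f g :: "'x \<Rightarrow> 'e::topological_space"
  assumes g: "g \<in> borel_measurable P" and eq: "AE x in P. f x = g x"
  shows "f \<in> borel_measurable (completion P)"
proof (rule measurableI)
  fix A :: "'e set" assume A: "A \<in> sets borel"
  define bad where "bad x \<longleftrightarrow> f x \<noteq> g x" for x
  define Q where "Q x \<longleftrightarrow> f x \<in> A \<and> bad x" for x
  have [measurable]: "Measurable.pred (completion P) (\<lambda>x. g x \<in> A)"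
    using measurable_completion[OF g] A by measurable
  have [measurable]: "Measurable.pred (completion P) bad" "Measurable.pred (completion P) Q"
    by (rule sets_completion_AE; use eq in \<open>auto simp: bad_def Q_def elim: eventually_mono\<close>)+
  have "Measurable.pred (completion P) (\<lambda>x. (g x \<in> A \<and> \<not> bad x) \<or> Q x)"
    by measurable
  also have "(\<lambda>x. (g x \<in> A \<and> \<not> bad x) \<or> Q x) = (\<lambda>x. f x \<in> A)"
    by (auto simp: bad_def Q_def fun_eq_iff)
  finally show "f -` A \<inter> space (completion P) \<in> sets (completion P)"
    by (simp add: pred_def vimage_def Int_def conj_commute)
qed simp

lemma expect_eq:
  fixes f g :: "'x \<Rightarrow> 'e::euclidean_space"
  assumes g: "g \<in> borel_measurable P" and eq: "AE x in P. f x = g x"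
  shows "expect P f = (\<integral>x. g x \<partial>P)"
proof -
  have "expect P f = (\<integral>x. g x \<partial>completion P)"
    unfolding expect_def
    by (rule integral_cong_AE) (use borel_measurable_completion_AE_eq[OF assms] measurable_completion[OF g] AE_completion[OF eq] in auto)
  then show ?thesis by (simp add: integral_completion[OF g])
qed

lemma tendsto_zero_of_smallo_inverse:
  fixes g :: "nat \<Rightarrow> 'e::real_normed_vector"
  assumes "(\<lambda>m. norm (g m)) \<in> o(\<lambda>m. 1 / real m)"
  shows "(\<lambda>m. real m *\<^sub>R g m) \<longlonglongrightarrow> 0"
proof -
  have "(\<lambda>m. norm (g m) / (1 / real m)) \<longlonglongrightarrow> 0" using assms by (rule smalloD_tendsto)
  then have "(\<lambda>m. norm (real m *\<^sub>R g m)) \<longlonglongrightarrow> 0" by (simp add: mult.commute)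
  then show ?thesis by (rule tendsto_norm_zero_cancel)
qed

lemma unique_argmax_D:
  assumes "unique_argmax f S z"
  shows "z \<in> S" and "w \<in> S \<Longrightarrow> f w \<le> f z" and "w \<in> S \<Longrightarrow> f w = f z \<Longrightarrow> w = z"
proof -
  have *: "is_arg_max f (\<lambda>z. z \<in> S) x \<longleftrightarrow> x = z" for x
    using assms unfolding unique_argmax_def by blast
  then have z: "is_arg_max f (\<lambda>z. z \<in> S) z" by blast
  then show "z \<in> S" "w \<in> S \<Longrightarrow> f w \<le> f z" by (auto simp: is_arg_max_def not_less)
  show "w = z" if "w \<in> S" "f w = f z"
    using *[of w] z that by (simp add: is_arg_max_def)
qed

text \<open>The likelihood equation for \<open>\<nu>\<close> alone; it gives \<open>e\<^sup>\<nu> = \<Z>(\<psi>) / \<Z>(\<theta>)\<close> at the maximum likelihood estimate.\<close>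

lemma argmax_first_order:
  assumes "\<And>v. c + v - exp v * Z \<le> c + u - exp u * Z"
  shows "exp u * (Z::real) = 1"
proof -
  have "((\<lambda>v. c + v - exp v * Z) has_real_derivative 1 - exp u * Z) (at u)"
    by (auto intro!: derivative_eq_intros)
  from DERIV_local_max[OF this, of 1] show ?thesis using assms by simp
qed

section \<open>Comparison of the two estimators\<close>

theorem theorem2:
  fixes \<Theta> :: "(real ^ 'd) set"
    and \<X> :: "(real ^ 'k) set"
    and \<mu> :: "(real ^ 'k) measure"
    and h :: "real ^ 'd \<Rightarrow> real ^ 'k \<Rightarrow> real"
    and h\<psi> :: "real ^ 'k \<Rightarrow> real"
    and n :: nat
    and y :: "nat \<Rightarrow> real ^ 'k"
    and M :: "'w measure"
    and X :: "nat \<Rightarrow> 'w \<Rightarrow> real ^ 'k"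
    and \<theta>h :: "real ^ 'd" and \<nu>h :: real
    and \<xi>IS \<xi>NCE :: "nat \<Rightarrow> 'w \<Rightarrow> (real ^ 'd) \<times> real"
  assumes Theta_open: "open \<Theta>"
    and sets_mu: "sets \<mu> = sets (restrict_space borel \<X>)"
    \<comment> \<open>the model\<close>
    and h_meas: "\<And>\<theta>. \<theta> \<in> \<Theta> \<Longrightarrow> h \<theta> \<in> borel_measurable \<mu>"
    and h_nonneg: "\<And>\<theta> x. \<theta> \<in> \<Theta> \<Longrightarrow> x \<in> \<X> \<Longrightarrow> 0 \<le> h \<theta> x"
    and h_integrable: "\<And>\<theta>. \<theta> \<in> \<Theta> \<Longrightarrow> integrable \<mu> (h \<theta>)"
    and Z_pos: "\<And>\<theta>. \<theta> \<in> \<Theta> \<Longrightarrow> 0 < norm_const \<mu> (h \<theta>)"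
    and identifiable: "inj_on (\<lambda>\<theta>. unnorm_prob \<mu> (h \<theta>)) \<Theta>"
    \<comment> \<open>the distribution of the artificial data\<close>
    and hpsi_meas: "h\<psi> \<in> borel_measurable \<mu>"
    and hpsi_nonneg: "\<And>x. x \<in> \<X> \<Longrightarrow> 0 \<le> h\<psi> x"
    and hpsi_integrable: "integrable \<mu> h\<psi>"
    and Zpsi_pos: "0 < norm_const \<mu> h\<psi>"
    and dominated: "\<And>\<theta>. \<theta> \<in> \<Theta> \<Longrightarrow>
          absolutely_continuous (unnorm_prob \<mu> h\<psi>) (unnorm_prob \<mu> (h \<theta>))"
    \<comment> \<open>the observed data and the MLE\<close>
    and n_ge_1: "n \<ge> 1"
    and y_in: "\<And>i. i \<in> {1..n} \<Longrightarrow> y i \<in> \<X> \<and> 0 < h\<psi> (y i)"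
    and mle: "unique_argmax (ext_loglik \<mu> h h\<psi> n y) (\<Theta> \<times> UNIV) (\<theta>h, \<nu>h)"
    \<comment> \<open>the artificial data and the estimators, as random variables\<close>
    and prob_M: "prob_space M"
    and X_rv: "\<And>j. j \<ge> 1 \<Longrightarrow> X j \<in> measurable M \<mu>"
    and IS_rv: "\<And>m. m \<ge> 1 \<Longrightarrow> \<xi>IS m \<in> borel_measurable M"
    and IS_in: "\<And>m \<omega>. m \<ge> 1 \<Longrightarrow> \<omega> \<in> space M \<Longrightarrow> \<xi>IS m \<omega> \<in> \<Theta> \<times> UNIV"
    and NCE_rv: "\<And>m. m \<ge> 1 \<Longrightarrow> \<xi>NCE m \<in> borel_measurable M"
    and NCE_in: "\<And>m \<omega>. m \<ge> 1 \<Longrightarrow> \<omega> \<in> space M \<Longrightarrow> \<xi>NCE m \<omega> \<in> \<Theta> \<times> UNIV"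
    \<comment> \<open>(X1)\<close>
    and X1: "ergodic_process M (unnorm_prob \<mu> h\<psi>) X"
    \<comment> \<open>(H2); the clause on \<open>X j\<close> says that the artificial points avoid the exceptional null set\<close>
    and H2_smooth: "\<exists>U. open U \<and> \<theta>h \<in> U \<and> U \<subseteq> \<Theta>
          \<and> (AE x in unnorm_prob \<mu> h\<psi>. C2_on U (\<lambda>\<theta>. h \<theta> x))
          \<and> (\<forall>i\<in>{1..n}. C2_on U (\<lambda>\<theta>. h \<theta> (y i)))
          \<and> (AE \<omega> in M. \<forall>j\<ge>1. C2_on U (\<lambda>\<theta>. h \<theta> (X j \<omega>)))"
    and H2_hessian: "bij (blinfun_apply (hessian (loglik_theta \<mu> h n y) \<theta>h))"
    and H2_int: "\<exists>\<epsilon>>0. ball \<theta>h \<epsilon> \<subseteq> \<Theta>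
          \<and> (\<integral>\<^sup>+x. env_a h \<theta>h \<epsilon> x * sup_ball \<theta>h \<epsilon> (\<lambda>\<theta>. h \<theta> x) \<partial>\<mu>) < \<infinity>"
    \<comment> \<open>(G1)\<close>
    and G1_IS: "AE \<omega> in M. (\<lambda>m. \<xi>IS m \<omega>) \<longlonglongrightarrow> (\<theta>h, \<nu>h)"
    and G1_NCE: "AE \<omega> in M. (\<lambda>m. \<xi>NCE m \<omega>) \<longlonglongrightarrow> (\<theta>h, \<nu>h)"
    and G1_grad_IS: "AE \<omega> in M.
          (\<lambda>m. norm (gradient (loglik_IS h h\<psi> n y m (\<lambda>j. X j \<omega>)) (\<xi>IS m \<omega>)))
            \<in> o(\<lambda>m. 1 / real m)"
    and G1_grad_NCE: "AE \<omega> in M.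
          (\<lambda>m. norm (gradient (loglik_NCE h h\<psi> n y m (\<lambda>j. X j \<omega>)) (\<xi>NCE m \<omega>)))
            \<in> o(\<lambda>m. 1 / real m)"
    \<comment> \<open>(I1)\<close>
    and I1: "\<exists>\<epsilon>>0. ball \<theta>h \<epsilon> \<subseteq> \<Theta>
          \<and> (\<integral>\<^sup>+x. env_b h \<theta>h \<epsilon> x * sup_ball \<theta>h \<epsilon> (\<lambda>\<theta>. (h \<theta> x / h\<psi> x)\<^sup>2)
               \<partial>(unnorm_prob \<mu> h\<psi>)) < \<infinity>"
  shows "AE \<omega> in M.
          (\<lambda>m. real m *\<^sub>R (\<xi>IS m \<omega> - \<xi>NCE m \<omega>)) \<longlonglongrightarrow>
            real n *\<^sub>R (inv (blinfun_apply (- hessian (loglik \<mu> h h\<psi> n y) (\<theta>h, \<nu>h)))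
                        (v_vec \<mu> h h\<psi> n y (\<theta>h, \<nu>h)))"
proof -
  define P where "P = unnorm_prob \<mu> h\<psi>"
  define Z\<psi> where "Z\<psi> = norm_const \<mu> h\<psi>"
  have Z\<psi>: "0 < Z\<psi>" using Zpsi_pos by (simp add: Z\<psi>_def)
  have space_mu: "space \<mu> = \<X>"
    using sets_eq_imp_space_eq[OF sets_mu] by (simp add: space_restrict_space)
  have sets_P: "sets P = sets \<mu>" by (simp add: P_def unnorm_prob_def)
  have space_P: "space P = \<X>" using sets_eq_imp_space_eq[OF sets_P] space_mu by simp

  have mle': "\<theta>h \<in> \<Theta>" "\<And>\<xi>. fst \<xi> \<in> \<Theta> \<Longrightarrow> ext_loglik \<mu> h h\<psi> n y \<xi> \<le> ext_loglik \<mu> h h\<psi> n y (\<theta>h, \<nu>h)"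
    "\<And>\<xi>. fst \<xi> \<in> \<Theta> \<Longrightarrow> ext_loglik \<mu> h h\<psi> n y \<xi> = ext_loglik \<mu> h h\<psi> n y (\<theta>h, \<nu>h) \<Longrightarrow> \<xi> = (\<theta>h, \<nu>h)"
    using unique_argmax_D[OF mle] by (auto simp: mem_Times_iff)
  \<comment> \<open>If an observation had density 0 at the maximiser, the maximum would be \<open>-\<infinity>\<close> and every parameter would attain it.\<close>
  have h_pos: "0 < h \<theta>h (y i)" if "i \<in> {1..n}" for i
  proof (rule ccontr)
    assume "\<not> 0 < h \<theta>h (y i)"
    then have "ext_loglik \<mu> h h\<psi> n y (\<theta>h, v) = -\<infinity>" for v
      using that by (auto simp: ext_loglik_def)
    then show False using mle'(3)[of "(\<theta>h, \<nu>h + 1)"] mle'(1) by simp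
  qed

  obtain U where U: "open U" "\<theta>h \<in> U" "U \<subseteq> \<Theta>" "AE x in P. C2_on U (\<lambda>\<theta>. h \<theta> x)"
      "\<And>i. i \<in> {1..n} \<Longrightarrow> C2_on U (\<lambda>\<theta>. h \<theta> (y i))" "AE \<omega> in M. \<forall>j\<ge>1. C2_on U (\<lambda>\<theta>. h \<theta> (X j \<omega>))"
    using H2_smooth unfolding P_def by blast
  obtain \<epsilon>a where \<epsilon>a: "0 < \<epsilon>a" "(\<integral>\<^sup>+x. env_a h \<theta>h \<epsilon>a x * sup_ball \<theta>h \<epsilon>a (\<lambda>\<theta>. h \<theta> x) \<partial>\<mu>) < \<infinity>"
    using H2_int by blast
  obtain \<epsilon>b where \<epsilon>b: "0 < \<epsilon>b" "(\<integral>\<^sup>+x. env_b h \<theta>h \<epsilon>b x * sup_ball \<theta>h \<epsilon>b (\<lambda>\<theta>. (h \<theta> x / h\<psi> x)\<^sup>2) \<partial>P) < \<infinity>"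
    using I1 unfolding P_def by blast
  have "eventually (\<lambda>t. t \<in> U) (nhds \<theta>h)" using U eventually_nhds by blast
  moreover have "eventually (\<lambda>t. \<forall>i\<in>{1..n}. 0 < h t (y i)) (nhds \<theta>h)"
  proof (rule eventually_ball_finite, simp, rule ballI)
    fix i assume i: "i \<in> {1..n}"
    have "isCont (\<lambda>t. h t (y i)) \<theta>h"
      using C2_on_continuous(1)[OF U(5)[OF i]] U continuous_on_eq_continuous_at by blast
    then show "eventually (\<lambda>t. 0 < h t (y i)) (nhds \<theta>h)"
      using h_pos[OF i] order_tendstoD(1) by (metis isCont_def tendsto_at_iff_tendsto_nhds)
  qed
  ultimately have "eventually (\<lambda>t. t \<in> U \<and> (\<forall>i\<in>{1..n}. 0 < h t (y i))) (nhds \<theta>h)"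
    by (rule eventually_conj)
  then obtain d where d: "0 < d" "\<And>t. dist t \<theta>h < d \<Longrightarrow> t \<in> U \<and> (\<forall>i\<in>{1..n}. 0 < h t (y i))"
    unfolding eventually_nhds_metric by blast
  define \<delta> where "\<delta> = min d (min \<epsilon>a \<epsilon>b)"
  have \<delta>: "0 < \<delta>" "\<delta> \<le> d" "\<delta> \<le> \<epsilon>a" "\<delta> \<le> \<epsilon>b" using d \<epsilon>a \<epsilon>b by (auto simp: \<delta>_def)
  \<comment> \<open>On \<open>V\<close> all smoothness and integrability assumptions are available, on \<open>V'\<close> also differentiation under the integral.\<close>
  define V where "V = ball \<theta>h \<delta>"
  define V' where "V' = ball \<theta>h (\<delta> / 2)"
  have V_U: "t \<in> U" and V_pos: "i \<in> {1..n} \<Longrightarrow> 0 < h t (y i)" if "t \<in> V" for t i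
    using d(2)[of t] that \<delta>(2) by (auto simp: V_def dist_commute)
  have V0: "open V" "\<theta>h \<in> V" "V \<subseteq> U" "V \<subseteq> \<Theta>" using \<delta>(1) V_U U(3) by (auto simp: V_def)
  have V': "open V'" "\<theta>h \<in> V'" "V' \<subseteq> V" using \<delta>(1) by (auto simp: V_def V'_def)

  interpret observed_data V \<theta>h h h\<psi> n y
    by unfold_locales (use V0 n_ge_1 C2_on_subset[OF U(5) V0(3)] V_pos y_in in auto)

  \<comment> \<open>The points of smoothness. Almost surely all artificial points lie in \<open>C\<close>, which need not be a measurable set.\<close>
  define C where "C = {x \<in> \<X>. C2_on V (\<lambda>t. h t x)}"
  have C_AE: "AE x in P. x \<in> C"
    using U(4) AE_space[of P] by eventually_elim (use C2_on_subset[OF _ V0(3)] space_P in \<open>auto simp: C_def\<close>)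
  have C_X: "AE \<omega> in M. \<forall>j\<ge>1. X j \<omega> \<in> C"
    using U(6) AE_space[of M]
    by eventually_elim (use C2_on_subset[OF _ V0(3)] measurable_space[OF X_rv] space_mu in \<open>auto simp: C_def\<close>)
  have CC2: "C2_on V (\<lambda>t. h t x)" and C_nonneg: "0 \<le> h\<psi> x" "t \<in> V \<Longrightarrow> 0 \<le> h t x" if "x \<in> C" for x t
    using that hpsi_nonneg h_nonneg V0(4) by (auto simp: C_def)

  define r where "r t x = h t x / h\<psi> x" for t x
  have r_meas: "r t \<in> borel_measurable P" if "t \<in> V" for t
    using h_meas[of t] hpsi_meas that V0(4) unfolding r_def[abs_def] measurable_cong_sets[OF sets_P refl] by auto
  have r_deriv: "((\<lambda>t. r t x) has_derivative (\<lambda>a. (dh t x /\<^sub>R h\<psi> x) \<bullet> a)) (at t)" if "x \<in> C" "t \<in> V" for x t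
    using has_derivative_mult_left[OF C2_on_has_derivative(1)[OF CC2[OF that(1)] that(2)], of "inverse (h\<psi> x)"]
    by (simp add: r_def[abs_def] divide_inverse mult.commute)
  have r'_deriv: "((\<lambda>t. dh t x /\<^sub>R h\<psi> x) has_derivative (\<lambda>a. ddh t x a /\<^sub>R h\<psi> x)) (at t)" if "x \<in> C" "t \<in> V" for x t
    by (intro has_derivative_scaleR_right C2_on_has_derivative(2)[OF CC2[OF that(1)] that(2)])

  \<comment> \<open>\<open>G\<close> and \<open>K\<close> are measurable everywhere and agree on \<open>C\<close> with the gradient and the Hessian of \<open>r\<close>.\<close>
  obtain g where g: "\<And>t d. t \<in> V \<Longrightarrow> g t d \<in> borel_measurable P" "\<And>t x. linear (\<lambda>d. g t d x)"
      "\<And>x t D. t \<in> V \<Longrightarrow> ((\<lambda>t. r t x) has_derivative D) (at t) \<Longrightarrow> (\<lambda>d. g t d x) = D"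
    using measurable_derivative[where f = r, OF V0(1) r_meas] by blast
  define G where "G t x = (\<Sum>b\<in>Basis. g t b x *\<^sub>R b)" for t x
  have G_meas: "G t \<in> borel_measurable P" if "t \<in> V" for t
    unfolding G_def[abs_def] using g(1)[OF that] by measurable
  have G_eq: "G t x = dh t x /\<^sub>R h\<psi> x" if "x \<in> C" "t \<in> V" for t x
    using fun_cong[OF g(3)[OF that(2) r_deriv[OF that]]] euclidean_representation[of "dh t x /\<^sub>R h\<psi> x"] by (simp add: G_def)
  have G_deriv: "((\<lambda>t. G t x) has_derivative (\<lambda>a. ddh t x a /\<^sub>R h\<psi> x)) (at t)" if "x \<in> C" "t \<in> V" for x t
    by (rule has_derivative_transform_within_open[OF r'_deriv[OF that] V0(1) that(2)]) (simp add: G_eq that(1))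
  obtain K where K: "\<And>t d. t \<in> V \<Longrightarrow> K t d \<in> borel_measurable P" "\<And>t x. linear (\<lambda>d. K t d x)"
      "\<And>x t D. t \<in> V \<Longrightarrow> ((\<lambda>t. G t x) has_derivative D) (at t) \<Longrightarrow> (\<lambda>d. K t d x) = D"
    using measurable_derivative[where f = G, OF V0(1) G_meas] by blast
  have K_eq: "K t a x = ddh t x a /\<^sub>R h\<psi> x" if "x \<in> C" "t \<in> V" for t a x
    using fun_cong[OF K(3)[OF that(2) G_deriv[OF that]]] .

  \<comment> \<open>\<open>w\<close> dominates \<open>r\<close> and its first two derivatives, \<open>w2\<close> dominates the damped squares. Dividing by \<open>h\<psi>\<close> turns the
    integrability with respect to \<open>\<mu>\<close> into integrability with respect to \<open>P\<close>.\<close>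
  define E where "E x = env_a h \<theta>h \<delta> x * sup_ball \<theta>h \<delta> (\<lambda>t. h t x)" for x
  define w where "w x = E x * ennreal (1 / h\<psi> x)" for x
  define w2 where "w2 x = env_b h \<theta>h \<delta> x * sup_ball \<theta>h \<delta> (\<lambda>t. (h t x / h\<psi> x)\<^sup>2)" for x
  have w_int: "(\<integral>\<^sup>+x. w x \<partial>P) < \<infinity>"
  proof -
    have "(\<integral>\<^sup>+x. w x \<partial>P) \<le> ennreal (1 / Z\<psi>) * (\<integral>\<^sup>+x. env_a h \<theta>h \<epsilon>a x * sup_ball \<theta>h \<epsilon>a (\<lambda>\<theta>. h \<theta> x) \<partial>\<mu>)"
      unfolding P_def unnorm_prob_def
    proof (rule nn_integral_density_le)
      show "(\<lambda>x. ennreal (h\<psi> x / norm_const \<mu> h\<psi>)) \<in> borel_measurable \<mu>" using hpsi_meas by measurable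
      show "0 < 1 / Z\<psi>" using Z\<psi> by simp
      fix x assume x: "x \<in> space \<mu>"
      have "ennreal (h\<psi> x / norm_const \<mu> h\<psi>) * w x = ennreal ((h\<psi> x / Z\<psi>) * (1 / h\<psi> x)) * E x"
        unfolding w_def using hpsi_nonneg x space_mu Z\<psi> by (subst ennreal_mult) (auto simp: mult_ac Z\<psi>_def)
      also have "\<dots> \<le> ennreal (1 / Z\<psi>) * (env_a h \<theta>h \<epsilon>a x * sup_ball \<theta>h \<epsilon>a (\<lambda>\<theta>. h \<theta> x))"
        unfolding E_def using Z\<psi> \<delta>(3)
        by (intro mult_mono ennreal_leI env_mono sup_ball_mono) auto
      finally show "ennreal (h\<psi> x / norm_const \<mu> h\<psi>) * w x
          \<le> ennreal (1 / Z\<psi>) * (env_a h \<theta>h \<epsilon>a x * sup_ball \<theta>h \<epsilon>a (\<lambda>\<theta>. h \<theta> x))" .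
    qed
    also have "\<dots> < \<infinity>" using \<epsilon>a(2) by (simp add: ennreal_mult_less_top)
    finally show ?thesis .
  qed
  have w2_int: "(\<integral>\<^sup>+x. w2 x \<partial>P) < \<infinity>"
  proof -
    have "(\<integral>\<^sup>+x. w2 x \<partial>P) \<le> (\<integral>\<^sup>+x. env_b h \<theta>h \<epsilon>b x * sup_ball \<theta>h \<epsilon>b (\<lambda>\<theta>. (h \<theta> x / h\<psi> x)\<^sup>2) \<partial>P)"
      unfolding w2_def using \<delta>(4) by (intro nn_integral_mono mult_mono env_mono sup_ball_mono) auto
    then show ?thesis using \<epsilon>b(2) by (rule le_less_trans)
  qed
  have scale: "ennreal (a / h\<psi> x) \<le> w x" if "ennreal a \<le> E x" "x \<in> C" "0 \<le> a" for a x
    using mult_right_mono[OF that(1), of "ennreal (1 / h\<psi> x)"] C_nonneg(1)[OF that(2)] that(3)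
    by (simp add: w_def flip: ennreal_mult)
  have w_r: "ennreal (norm (r t x)) \<le> w x"
    and w_dh: "ennreal (norm (dh t x /\<^sub>R h\<psi> x)) \<le> w x"
    and w_ddh: "b \<in> Basis \<Longrightarrow> ennreal (norm (ddh t x b /\<^sub>R h\<psi> x)) \<le> w x"
    if "x \<in> C" "t \<in> V" for t x b
  proof -
    note env = env_a_bounds[where h = h and x = x, OF CC2[OF that(1), unfolded V_def] C_nonneg(2)[OF that(1), unfolded V_def] that(2)[unfolded V_def],
        folded E_def]
    show "ennreal (norm (r t x)) \<le> w x"
      using scale[OF env(1) that(1)] C_nonneg[OF that(1)] that(2) by (simp add: r_def)
    show "ennreal (norm (dh t x /\<^sub>R h\<psi> x)) \<le> w x"
      using scale[OF env(2) that(1)] C_nonneg(1)[OF that(1)] by (simp add: divide_inverse mult.commute)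
    show "ennreal (norm (ddh t x b /\<^sub>R h\<psi> x)) \<le> w x" if "b \<in> Basis"
      using scale[OF env(3)[of b, unfolded norm_Basis[OF that] ennreal_1 mult_1_right] \<open>x \<in> C\<close>] C_nonneg(1)[OF \<open>x \<in> C\<close>]
      by (simp add: divide_inverse mult.commute)
  qed
  have cont: "continuous_on V (\<lambda>t. r t x)" "continuous_on V (\<lambda>t. dh t x /\<^sub>R h\<psi> x)" "continuous_on V (\<lambda>t. ddh t x a /\<^sub>R h\<psi> x)"
    if "x \<in> C" for x a
    unfolding r_def divide_inverse
    by (intro continuous_intros C2_on_continuous[OF CC2[OF that]])+
  have contG: "continuous_on V (\<lambda>t. G t x)" and contK: "continuous_on V (\<lambda>t. K t a x)" if "x \<in> C" for x a
    using cont[OF that] by (simp_all add: G_eq K_eq that cong: continuous_on_cong)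

  \<comment> \<open>The ratio of normalising constants, its gradient, and its Hessian at the maximum likelihood estimate.\<close>
  define Z where "Z t = (\<integral>x. r t x \<partial>P)" for t
  define dZ where "dZ t = (\<integral>x. G t x \<partial>P)" for t
  define ddZ where "ddZ a = (\<integral>x. K \<theta>h a x \<partial>P)" for a
  have G_int: "integrable P (G t)" if "t \<in> V" for t
    by (rule integrable_of_bound[OF G_meas[OF that] C_AE _ w_int]) (use that G_eq w_dh in simp)
  have K_int: "integrable P (K \<theta>h b)" if "b \<in> Basis" for b
    by (rule integrable_of_bound[OF K(1)[OF V0(2)] C_AE _ w_int]) (use that K_eq w_ddh V0(2) in simp)
  have Z_deriv: "(Z has_derivative (\<lambda>a. dZ t \<bullet> a)) (at t)" if t: "t \<in> V'" for t
  proof -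
    have "((\<lambda>t. \<integral>x. r t x \<partial>P) has_derivative (\<lambda>a. \<integral>x. G t x \<bullet> a \<partial>P)) (at t)"
    proof (rule has_derivative_integral_ball[OF t[unfolded V'_def] _ _ _ C_AE _ _ _ _ w_int, where D = "\<lambda>t a x. G t x \<bullet> a"], fold V_def)
      show "(\<lambda>x. G t x \<bullet> a) \<in> borel_measurable P" if "t \<in> V" for t a
        using G_meas[OF that] by measurable
      show "((\<lambda>t. r t x) has_derivative (\<lambda>a. G t x \<bullet> a)) (at t)" if "x \<in> C" "t \<in> V" for x t
        using r_deriv[OF that] by (simp add: G_eq[OF that])
      show "ennreal (norm (G t x \<bullet> b)) \<le> w x" if "x \<in> C" "t \<in> V" "b \<in> Basis" for x t b
        using w_dh[OF that(1,2)] Basis_le_norm[OF that(3), of "G t x"]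
        unfolding G_eq[OF that(1,2)] real_norm_def by (meson ennreal_leI order_trans)
    qed (auto intro!: r_meas w_r[unfolded real_norm_def] continuous_intros contG linearI simp: inner_add_right)
    then show ?thesis using t V'(3) G_int by (simp add: Z_def[abs_def] dZ_def subset_iff)
  qed
  have dZ_deriv: "(dZ has_derivative ddZ) (at \<theta>h)"
    unfolding dZ_def[abs_def] ddZ_def[abs_def]
  proof (rule has_derivative_integral_ball[OF V'(2)[unfolded V'_def] _ _ K(2) C_AE _ _ _ _ w_int], fold V_def)
    show "((\<lambda>t. G t x) has_derivative (\<lambda>a. K t a x)) (at t)" if "x \<in> C" "t \<in> V" for x t
      unfolding K_eq[OF that] by (rule G_deriv[OF that])
    show "ennreal (norm (G t x)) \<le> w x" "b \<in> Basis \<Longrightarrow> ennreal (norm (K t b x)) \<le> w x" if "x \<in> C" "t \<in> V" for t x b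
      unfolding G_eq[OF that] K_eq[OF that] by (rule w_dh[OF that], rule w_ddh[OF that])
  qed (rule G_meas K(1) contK; assumption)+
  have ddZ_lin: "linear ddZ" using has_derivative_linear[OF dZ_deriv] .

  have Z_eq: "norm_const \<mu> (h t) / Z\<psi> = Z t" if "t \<in> \<Theta>" for t
    unfolding Z_def r_def P_def Z\<psi>_def
    by (rule norm_const_ratio) (use that h_meas hpsi_meas hpsi_nonneg h_nonneg space_mu Z_pos Zpsi_pos dominated in auto)
  have Z_pos': "0 < Z t" if "t \<in> \<Theta>" for t
    using Z_eq[OF that] Z_pos[OF that] Z\<psi> by (metis divide_pos_pos)
  have loglik_eq: "loglik \<mu> h h\<psi> n y (t, v) = obs t + v - exp v * Z t" if "t \<in> \<Theta>" for t v
    unfolding loglik_def prod.case Z\<psi>_def[symmetric] Z_eq[OF that] obs_def ..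

  have norm1: "exp \<nu>h * Z \<theta>h = 1"
  proof (rule argmax_first_order[of "obs \<theta>h"])
    fix v
    show "obs \<theta>h + v - exp v * Z \<theta>h \<le> obs \<theta>h + \<nu>h - exp \<nu>h * Z \<theta>h"
      using mle'(2)[of "(\<theta>h, v)"] mle'(1) h_pos loglik_eq[OF mle'(1)] by (simp add: ext_loglik_def)
  qed

  define H where "H = score_deriv ddZ (dZ \<theta>h) (Z \<theta>h) (\<theta>h, \<nu>h)"
  have H_deriv: "(score dZ Z has_derivative H) (at (\<theta>h, \<nu>h))"
    unfolding H_def by (rule has_derivative_score[OF V0(2) Z_deriv[OF V'(2)] dZ_deriv])
  have H_lin: "linear H" using has_derivative_linear[OF H_deriv] .
  have hess: "blinfun_apply (hessian (loglik \<mu> h h\<psi> n y) (\<theta>h, \<nu>h)) = H"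
  proof (rule hessian_eqI[of "V' \<times> UNIV", OF _ _ _ H_deriv])
    show op: "open (V' \<times> (UNIV :: real set))" using V' by (intro open_Times) auto
    fix \<xi> :: "(real ^ 'd) \<times> real" assume \<xi>: "\<xi> \<in> V' \<times> UNIV"
    then have t: "fst \<xi> \<in> V'" by auto
    then have "((\<lambda>(t, v). obs t + v - exp v * Z t) has_derivative (\<lambda>d. score dZ Z (fst \<xi>, snd \<xi>) \<bullet> d)) (at (fst \<xi>, snd \<xi>))"
      using V'(3) by (intro has_derivative_loglik_score Z_deriv) auto
    then have D: "((\<lambda>(t, v). obs t + v - exp v * Z t) has_derivative (\<lambda>d. score dZ Z \<xi> \<bullet> d)) (at \<xi>)" by simp
    show "(loglik \<mu> h h\<psi> n y has_derivative (\<lambda>d. score dZ Z \<xi> \<bullet> d)) (at \<xi>)"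
    proof (rule has_derivative_transform_within_open[OF D op \<xi>])
      fix z :: "(real ^ 'd) \<times> real" assume "z \<in> V' \<times> UNIV"
      then show "(case z of (t, v) \<Rightarrow> obs t + v - exp v * Z t) = loglik \<mu> h h\<psi> n y z"
        using loglik_eq V'(3) V0(4) by (cases z) auto
    qed
  qed (use V' in auto)

  have hess_theta: "blinfun_apply (hessian (loglik_theta \<mu> h n y) \<theta>h)
      = (\<lambda>a. obs_hess \<theta>h a - (ddZ a /\<^sub>R Z \<theta>h - ((dZ \<theta>h \<bullet> a) / (Z \<theta>h)\<^sup>2) *\<^sub>R dZ \<theta>h))"
  proof (rule hessian_eqI[OF V'(1,2), where G = "\<lambda>t. obs_grad t - dZ t /\<^sub>R Z t"])
    show "((\<lambda>t. obs_grad t - dZ t /\<^sub>R Z t) has_derivative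
        (\<lambda>a. obs_hess \<theta>h a - (ddZ a /\<^sub>R Z \<theta>h - ((dZ \<theta>h \<bullet> a) / (Z \<theta>h)\<^sup>2) *\<^sub>R dZ \<theta>h))) (at \<theta>h)"
      by (intro has_derivative_diff has_derivative_obs_grad V0(2)
          has_derivative_scaled_gradient[OF Z_deriv[OF V'(2)] dZ_deriv] Z_pos' mle'(1))
    fix t assume t: "t \<in> V'"
    have tV: "t \<in> V" "t \<in> \<Theta>" using t V' V0 by auto
    have "((\<lambda>t. (1 / n) * (\<Sum>i=1..n. ln (h t (y i))) - (ln Z\<psi> + ln (Z t))) has_derivative
        (\<lambda>a. obs_grad t \<bullet> a - (0 + (dZ t /\<^sub>R Z t) \<bullet> a))) (at t)"
      by (intro has_derivative_diff has_derivative_add has_derivative_const has_derivative_obs_ln tV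
          has_derivative_gradient_ln Z_deriv t Z_pos')
    then have D: "((\<lambda>t. (1 / n) * (\<Sum>i=1..n. ln (h t (y i))) - (ln Z\<psi> + ln (Z t))) has_derivative
        (\<lambda>a. (obs_grad t - dZ t /\<^sub>R Z t) \<bullet> a)) (at t)" by (simp add: inner_diff_left)
    show "(loglik_theta \<mu> h n y has_derivative (\<lambda>a. (obs_grad t - dZ t /\<^sub>R Z t) \<bullet> a)) (at t)"
    proof (rule has_derivative_transform_within_open[OF D V'(1) t])
      fix s assume "s \<in> V'"
      then have s: "s \<in> \<Theta>" using V' V0 by auto
      have "norm_const \<mu> (h s) = Z\<psi> * Z s" using Z_eq[OF s] Z\<psi> by (simp add: field_simps)
      then show "(1 / n) * (\<Sum>i=1..n. ln (h s (y i))) - (ln Z\<psi> + ln (Z s)) = loglik_theta \<mu> h n y s"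
        using ln_mult_pos[OF Z\<psi> Z_pos'[OF s]] by (simp add: loglik_theta_def)
    qed
  qed
  have H_bij: "bij H"
    unfolding H_def
    by (rule bij_score_deriv[OF H_lin[unfolded H_def] norm1 bij_is_inj[OF H2_hessian, unfolded hess_theta] ddZ_lin])

  \<comment> \<open>\<open>F\<close> is the damped square as a function of the joint parameter \<open>(t, \<tau>)\<close>, and \<open>S\<close> its measurable version.\<close>
  define S where "S p x = (1 / (1 + \<bar>snd p\<bar> * r (fst p) x)) *\<^sub>R (r (fst p) x *\<^sub>R (G (fst p) x, r (fst p) x))" for p x
  define F where "F p x = (1 / (1 + \<bar>snd p\<bar> * r (fst p) x)) *\<^sub>R (r (fst p) x *\<^sub>R (dh (fst p) x /\<^sub>R h\<psi> x, r (fst p) x))" for p x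
  define q where "q = (\<integral>x. S (\<theta>h, 0) x \<partial>P)"
  have S_meas: "S p \<in> borel_measurable P" if "p \<in> V \<times> UNIV" for p
    using r_meas[of "fst p"] G_meas[of "fst p"] that unfolding S_def[abs_def] by (auto intro!: borel_measurable_Pair)
  have S_F: "S p x = F p x" if "x \<in> C" "p \<in> V \<times> UNIV" for p x
    using that by (auto simp: S_def F_def G_eq)
  have r_nonneg: "0 \<le> r t x" if "x \<in> C" "t \<in> V" for t x
    using C_nonneg[OF that(1)] that(2) by (simp add: r_def)
  have F_cont: "continuous_on (V \<times> UNIV) (\<lambda>p. F p x)" if "x \<in> C" for x
  proof -
    have "1 + \<bar>snd p\<bar> * r (fst p) x \<noteq> 0" if "p \<in> V \<times> UNIV" for p :: "(real ^ 'd) \<times> real"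
      using mult_nonneg_nonneg[OF abs_ge_zero[of "snd p"] r_nonneg[OF \<open>x \<in> C\<close>, of "fst p"]] that by auto
    then show ?thesis
      unfolding F_def
      by (intro continuous_intros continuous_on_compose2[OF cont(1)[OF that]] continuous_on_compose2[OF cont(2)[OF that]]) auto
  qed
  have F_bound: "ennreal (norm (F p x)) \<le> w2 x" if x: "x \<in> C" and p: "p \<in> V \<times> UNIV" for p x
  proof -
    have t: "fst p \<in> V" using p by auto
    let ?r = "r (fst p) x"
    have r: "0 \<le> ?r" by (rule r_nonneg[OF x t])
    have "norm (F p x) = (1 / (1 + \<bar>snd p\<bar> * ?r)) * norm (?r *\<^sub>R (dh (fst p) x /\<^sub>R h\<psi> x, ?r))"
      unfolding F_def by (subst norm_scaleR) (use r in simp)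
    also have "\<dots> \<le> 1 * norm (?r *\<^sub>R (dh (fst p) x /\<^sub>R h\<psi> x, ?r))"
      by (rule mult_right_mono) (use mult_nonneg_nonneg[OF abs_ge_zero[of "snd p"] r] in \<open>auto simp: divide_le_eq_1\<close>)
    also have "\<dots> = ?r * norm (dh (fst p) x /\<^sub>R h\<psi> x, ?r)"
      unfolding mult_1_left by (subst norm_scaleR) (use r in simp)
    also have "\<dots> \<le> ?r * (norm (dh (fst p) x /\<^sub>R h\<psi> x) + norm ?r)"
      by (rule mult_left_mono[OF norm_Pair_le r])
    also have "\<dots> = ?r * (norm (dh (fst p) x) / h\<psi> x) + ?r\<^sup>2"
      using r C_nonneg(1)[OF x] by (simp add: power2_eq_square distrib_left divide_inverse mult.commute)
    finally have "ennreal (norm (F p x)) \<le> ennreal (?r * (norm (dh (fst p) x) / h\<psi> x) + ?r\<^sup>2)" by (rule ennreal_leI)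
    also have "\<dots> \<le> w2 x"
      unfolding w2_def r_def
      by (rule env_b_bound[where h = h and x = x, OF CC2[OF x, unfolded V_def] C_nonneg(2)[OF x, unfolded V_def] t[unfolded V_def] C_nonneg(1)[OF x]])
    finally show ?thesis .
  qed

  define vv where "vv = (1 / real n) *\<^sub>R (\<Sum>i=1..n. (h \<theta>h (y i) / h\<psi> (y i) * exp \<nu>h) *\<^sub>R (dh \<theta>h (y i) /\<^sub>R h \<theta>h (y i), 1::real))
      - exp (2 * \<nu>h) *\<^sub>R q"
  have g_grad: "gradient (\<lambda>z. g_fun h z x) (\<theta>h, \<nu>h) = (dh \<theta>h x /\<^sub>R h \<theta>h x, 1)"
    if D: "C2_on V (\<lambda>t. h t x)" and pos: "0 < h \<theta>h x" for x
  proof (rule gradient_eqI)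
    have "((\<lambda>z. ln (h (fst z) x)) has_derivative (\<lambda>d. (dh \<theta>h x /\<^sub>R h \<theta>h x) \<bullet> fst d)) (at (\<theta>h, \<nu>h))"
      by (rule has_derivative_compose[OF has_derivative_fst[OF has_derivative_ident], where g = "\<lambda>t. ln (h t x)"])
         (simp only: fst_conv, rule has_derivative_gradient_ln[OF C2_on_has_derivative(1)[OF D V0(2)] pos])
    from has_derivative_add[OF this has_derivative_snd[OF has_derivative_ident]]
    show "((\<lambda>z. g_fun h z x) has_derivative (\<lambda>d. (dh \<theta>h x /\<^sub>R h \<theta>h x, 1) \<bullet> d)) (at (\<theta>h, \<nu>h))"
      unfolding g_fun_def by (rule has_derivative_eq_rhs) (simp add: inner_prod_def fun_eq_iff)
  qed
  \<comment> \<open>Where \<open>h\<close> vanishes the integrand of \<open>v\<close> is 0 whatever the gradient of \<open>log h\<close>; elsewhere the factor \<open>h\<close> cancels its denominator.\<close>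
  have v_eq: "v_vec \<mu> h h\<psi> n y (\<theta>h, \<nu>h) = vv"
  proof -
    have "expect P (\<lambda>x. ((exp_g h (\<theta>h, \<nu>h) x / h\<psi> x)\<^sup>2) *\<^sub>R gradient (\<lambda>z. g_fun h z x) (\<theta>h, \<nu>h))
        = (\<integral>x. exp (2 * \<nu>h) *\<^sub>R S (\<theta>h, 0) x \<partial>P)"
    proof (rule expect_eq)
      show "(\<lambda>x. exp (2 * \<nu>h) *\<^sub>R S (\<theta>h, 0) x) \<in> borel_measurable P"
        using S_meas[of "(\<theta>h, 0)"] V0(2) by simp
      show "AE x in P. ((exp_g h (\<theta>h, \<nu>h) x / h\<psi> x)\<^sup>2) *\<^sub>R gradient (\<lambda>z. g_fun h z x) (\<theta>h, \<nu>h) = exp (2 * \<nu>h) *\<^sub>R S (\<theta>h, 0) x"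
        using C_AE
      proof eventually_elim
        case (elim x)
        have e: "exp (2 * \<nu>h) = exp \<nu>h * exp \<nu>h" by (simp flip: exp_add)
        have S: "S (\<theta>h, 0) x = r \<theta>h x *\<^sub>R (dh \<theta>h x /\<^sub>R h\<psi> x, r \<theta>h x)"
          using V0(2) by (simp add: S_def G_eq[OF elim])
        show ?case
        proof (cases "h \<theta>h x = 0")
          case True
          then show ?thesis by (simp add: S r_def exp_g_def zero_prod_def)
        next
          case False
          then have "0 < h \<theta>h x" using C_nonneg(2)[OF elim V0(2)] by simp
          then show ?thesis unfolding S g_grad[OF CC2[OF elim] \<open>0 < h \<theta>h x\<close>] e
            by (simp add: r_def exp_g_def power2_eq_square divide_inverse mult_ac)
        qed
      qed
    qed
    also have "\<dots> = exp (2 * \<nu>h) *\<^sub>R q" by (simp add: q_def)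
    finally have "expect (unnorm_prob \<mu> h\<psi>) (\<lambda>x. ((exp_g h (\<theta>h, \<nu>h) x / h\<psi> x)\<^sup>2) *\<^sub>R gradient (\<lambda>z. g_fun h z x) (\<theta>h, \<nu>h))
        = exp (2 * \<nu>h) *\<^sub>R q" by (simp add: P_def)
    then show ?thesis
      unfolding v_vec_def vv_def using g_grad[OF y_C2 h_pos] by (simp add: exp_g_def)
  qed
  have inv_eq: "real n *\<^sub>R inv (blinfun_apply (- hessian (loglik \<mu> h h\<psi> n y) (\<theta>h, \<nu>h))) vv = inv H (- (real n *\<^sub>R vv))"
  proof -
    have neg: "blinfun_apply (- hessian (loglik \<mu> h h\<psi> n y) (\<theta>h, \<nu>h)) = (\<lambda>z. - H z)"
      using hess by (auto simp: fun_eq_iff blinfun.minus_left)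
    have "surj (\<lambda>z. - H z)" using bij_is_surj[OF H_bij] unfolding surj_def by (metis minus_minus)
    then have "- H (inv (\<lambda>z. - H z) vv) = vv" by (rule surj_f_inv_f)
    then have "H (inv (\<lambda>z. - H z) vv) = - vv" by (metis minus_minus)
    then have "H (real n *\<^sub>R inv (\<lambda>z. - H z) vv) = - (real n *\<^sub>R vv)"
      by (simp add: linear_cmul[OF H_lin])
    then show ?thesis unfolding neg using bij_is_inj[OF H_bij] by (metis inv_f_f)
  qed

  have erg: "ergodic_process M P X" using X1 by (simp add: P_def)
  \<comment> \<open>The four almost sure events on which the deterministic argument runs.\<close>
  have avg_r: "AE \<omega> in M. ((\<lambda>(m, t). (\<Sum>j=1..m. r t (X j \<omega>)) /\<^sub>R real m) \<longlongrightarrow> Z \<theta>h) (sequentially \<times>\<^sub>F nhds \<theta>h)"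
    unfolding Z_def by (rule uniform_ergodic_average_version[OF erg V0(1,2) r_meas C_AE C_X _ cont(1) w_r w_int]) auto
  have avg_G: "AE \<omega> in M. ((\<lambda>(m, t). (\<Sum>j=1..m. dh t (X j \<omega>) /\<^sub>R h\<psi> (X j \<omega>)) /\<^sub>R real m) \<longlongrightarrow> dZ \<theta>h) (sequentially \<times>\<^sub>F nhds \<theta>h)"
    unfolding dZ_def by (rule uniform_ergodic_average_version[OF erg V0(1,2) G_meas C_AE C_X G_eq cont(2) w_dh w_int])
  have avg_K: "AE \<omega> in M. \<forall>b\<in>Basis. ((\<lambda>(m, t). (\<Sum>j=1..m. ddh t (X j \<omega>) b /\<^sub>R h\<psi> (X j \<omega>)) /\<^sub>R real m) \<longlongrightarrow> ddZ b) (sequentially \<times>\<^sub>F nhds \<theta>h)"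
    unfolding ddZ_def
    by (intro AE_finite_allI uniform_ergodic_average_version[OF erg V0(1,2) K(1) C_AE C_X K_eq cont(3) w_ddh w_int]) auto
  have avg_F: "AE \<omega> in M. ((\<lambda>(m, p). (\<Sum>j=1..m. F p (X j \<omega>)) /\<^sub>R real m) \<longlongrightarrow> q) (sequentially \<times>\<^sub>F nhds (\<theta>h, 0))"
    unfolding q_def
    by (rule uniform_ergodic_average_version[OF erg open_Times[OF V0(1) open_UNIV] _ S_meas C_AE C_X S_F F_cont F_bound w2_int])
       (use V0(2) in auto)

  show ?thesis
    using avg_r avg_G avg_K avg_F C_X G1_IS G1_NCE G1_grad_IS G1_grad_NCE
  proof eventually_elim
    case (elim \<omega>)
    interpret realisation V \<theta>h h h\<psi> n y "\<lambda>j. X j \<omega>"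
      by unfold_locales (use elim(5) CC2 C_nonneg in auto)
    have damped_square: "damped_square p x = F p x" for p x by (simp add: damped_square_def F_def r_def case_prod_unfold)
    show ?case
      unfolding v_eq inv_eq unfolding vv_def H_def
    proof (rule estimator_difference_limit)
      show "((\<lambda>(m, t). emp m t) \<longlongrightarrow> Z \<theta>h) (sequentially \<times>\<^sub>F nhds \<theta>h)"
        using elim(1) by (simp add: emp_def r_def)
      show "((\<lambda>(m, t). emp_grad m t) \<longlongrightarrow> dZ \<theta>h) (sequentially \<times>\<^sub>F nhds \<theta>h)"
        using elim(2) by (simp add: emp_grad_def)
      show "((\<lambda>(m, t). emp_hess m t b) \<longlongrightarrow> ddZ b) (sequentially \<times>\<^sub>F nhds \<theta>h)" if "b \<in> Basis" for b
        using elim(3) that by (simp add: emp_hess_def)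
      show "((\<lambda>(m, p). emp_damped_square m p) \<longlongrightarrow> q) (sequentially \<times>\<^sub>F nhds (\<theta>h, 0))"
        using elim(4) by (simp add: emp_damped_square_def damped_square)
    qed (use elim(6-9) tendsto_zero_of_smallo_inverse H_lin H_bij ddZ_lin in \<open>auto simp: H_def\<close>)
  qed
qed

end
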